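(* Let $\beta\in\mathbb{R}$ and let $p$ be analytic on $\mathbb{D}$ with $p(0)=1$ and $$1+\beta\frac{zp'(z)}{p^2(z)}\prec\varphi_{Ne}(z)=1+z-\frac{z^3}{3}.$$ Then the following subordinations hold: (a) $p(z)\prec\sqrt{1+z^2}+z$ whenever $\beta\geq\frac{4}{9}(2+\sqrt{2})\approx1.51743$. (b) $p(z)\prec1+\frac{4}{3}z+\frac{2}{3}z^2$ whenever $\beta\geq\frac{4}{3}$. (c) $p(z)\prec1+\sqrt{2}z+\frac{1}{2}z^2$ whenever $\beta\geq\frac{8}{63}(5+4\sqrt{2})\approx1.35325$. (d) $p(z)\prec e^z$ whenever $\beta\geq\frac{8e}{9(e-1)}\approx1.4062$. (e) $p(z)\prec1+\sin z$ whenever $\beta\geq\frac{8(1+\sin1)}{9\sin1}\approx1.94524$. (f) $p(z)\prec1+\frac{z}{k}\left(\frac{k+z}{k-z}\right)$, where $k=1+\sqrt{2}$, whenever $\beta\geq\frac{16}{9}(1+\sqrt{2})\approx4.29194$. (g) $p(z)\prec\varphi_{Ne}(z)$ whenever $\beta\geq\frac{20}{9}$. The bounds on $\beta$ are best possible, i.e. in each part the lower bound on $\beta$ cannot be replaced by a smaller number.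
   Context: $\mathbb{D}$ is the open unit disk. For analytic $f,g$ on $\mathbb{D}$, $f\prec g$ means there is an analytic $w$ on $\mathbb{D}$ with $w(0)=0$, $|w(z)|<1$ and $f(z)=g(w(z))$ on $\mathbb{D}$; in particular the left-hand side of the hypothesis is understood to be analytic on $\mathbb{D}$. The principal branch of the square root is used. *)

theory Defs
  imports "HOL-Complex_Analysis.Complex_Analysis"
begin

definition subordinate :: "(complex \<Rightarrow> complex) \<Rightarrow> (complex \<Rightarrow> complex) \<Rightarrow> bool"
    (infix "\<prec>" 50) where
  "f \<prec> g \<longleftrightarrow> f holomorphic_on ball 0 1 \<and> g holomorphic_on ball 0 1 \<and>
     (\<exists>w. w holomorphic_on ball 0 1 \<and> w 0 = 0 \<and>
       (\<forall>z\<in>ball 0 1. norm (w z) < 1) \<and> (\<forall>z\<in>ball 0 1. f z = g (w z)))"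

definition phi_Ne :: "complex \<Rightarrow> complex" where
  "phi_Ne z = 1 + z - z ^ 3 / 3"

text \<open>A zero of \<open>p\<close> in the disk would be a pole of \<open>z p'(z) / p(z)^2\<close>.  So for \<open>\<beta> \<noteq> 0\<close> the
  analyticity that the subordination demands of its left-hand side forces \<open>p\<close> to be zero-free,
  and the convention \<open>x / 0 = 0\<close> plays no role.\<close>

definition nephroid_hyp :: "real \<Rightarrow> (complex \<Rightarrow> complex) \<Rightarrow> bool" where
  "nephroid_hyp \<beta> p \<longleftrightarrow> p holomorphic_on ball 0 1 \<and> p 0 = 1 \<and>
     (\<lambda>z. 1 + of_real \<beta> * (z * deriv p z / (p z)\<^sup>2)) \<prec> phi_Ne"

definition valid_bound :: "(complex \<Rightarrow> complex) \<Rightarrow> real \<Rightarrow> bool" where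
  "valid_bound \<phi> b \<longleftrightarrow> (\<forall>\<beta> p. nephroid_hyp \<beta> p \<and> \<beta> \<ge> b \<longrightarrow> p \<prec> \<phi>)"

text \<open>The bound \<open>b\<close> is valid and cannot be replaced by any smaller number.  Sharpness does not say
  that the implication fails for every single \<open>\<beta> < b\<close>; that is false for very negative \<open>\<beta>\<close>.\<close>

definition best_bound :: "(complex \<Rightarrow> complex) \<Rightarrow> real \<Rightarrow> bool" where
  "best_bound \<phi> b \<longleftrightarrow> valid_bound \<phi> b \<and> (\<forall>b'<b. \<not> valid_bound \<phi> b')"

end

theory Submission imports Defs begin

text \<open>Put \<open>H z = z - z\<^sup>3/9\<close>, so that \<open>z H'(z) = z - z\<^sup>3/3\<close>.  The hypothesis with \<open>\<beta> \<ge> b\<close> says that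
  \<open>G = b (1 - 1/p)\<close> satisfies \<open>z G'(z) = c (w - w\<^sup>3/3)\<close> for a Schwarz function \<open>w\<close> and \<open>c = b/\<beta> \<le> 1\<close>.
  If \<open>G\<close> left the range of \<open>H\<close>, Jack's lemma at the first exit point would contradict the
  starlikeness of the nephroid; hence \<open>G\<close> is subordinate to \<open>H\<close> and \<open>p\<close> to the extremal function
  \<open>1 / (1 - H/b)\<close>.  It remains to compare the extremal function with each majorant \<open>\<phi>\<close>.  An explicit
  inverse of \<open>\<phi>\<close> gives a candidate for the Schwarz function, and its modulus stays below \<open>1\<close> because
  \<open>b (1 - 1/\<phi>)\<close> maps the unit circle outside the range of \<open>H\<close>, which lies in the strip \<open>|Re| < 8/9\<close> and
  in the disk of radius \<open>10/9\<close>.  The extremal function attains the critical real value at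
  \<open>1\<close> (for the sixth majorant at \<open>-1\<close>), which makes the bounds sharp.\<close>

subsection \<open>Starlikeness and Jack's lemma\<close>

text \<open>The constants are 8/9 = H(1) and 10/9 = |H(i)|. With M = \<phi>(1), the extremal
  function reaches M at 1 exactly when b (1 - 1/M) = 8/9, that is b = 8 M / (9 (M - 1)). All bounds
  but the sixth arise in this way; the sixth comes from b (1 - 1/\<phi>(-1)) = -8/9. The range of H
  touches the line Re = 8/9 at the critical value, so near the contact point a comparison must be
  exact there and the half-plane is used; far from it the crude disk of radius 10/9 suffices. This
  is why the unit circle is split in two for every majorant. Two difficulties shape the rest. Jack's
  lemma is applied at a point that is mapped onto the unit circle, so the inverse of H has to be
  analytic beyond the closed disk; the distance sqrt 3 to the critical points of H leaves the room.
  And subordination is not derived from inclusion of ranges and univalence of \<phi>: an explicit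
  root w of \<phi>(w) = v, analytic along the values v of the extremal function and equal to 0 at v
  = 1, takes the place of univalence.\<close>

definition nephroid_primitive :: "complex \<Rightarrow> complex" where
  "nephroid_primitive z = z - z ^ 3 / 9"

definition extremal :: "real \<Rightarrow> complex \<Rightarrow> complex" where
  "extremal b z = 1 / (1 - nephroid_primitive z / of_real b)"

lemma nephroid_primitive_0 [simp]: "nephroid_primitive 0 = 0"
  by (simp add: nephroid_primitive_def)

lemma has_field_derivative_nephroid_primitive:
  "(nephroid_primitive has_field_derivative 1 - z\<^sup>2 / 3) (at z within S)"
  unfolding nephroid_primitive_def [abs_def]
  by (auto intro!: derivative_eq_intros simp: power2_eq_square)

lemma holomorphic_nephroid_primitive [holomorphic_intros]:
  "f holomorphic_on S \<Longrightarrow> (\<lambda>z. nephroid_primitive (f z)) holomorphic_on S"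
  unfolding nephroid_primitive_def by (auto intro!: holomorphic_intros)

text \<open>The difference of two values is \<open>x - y\<close> times a multiple of 9 - (x^2 + x y
  + y^2), which cannot vanish while both moduli are below sqrt 3. That radius is the distance to the
  zeros of the derivative, hence maximal. As it exceeds 1, the inverse is analytic across the image
  of the unit circle.\<close>

lemma inj_on_nephroid_primitive: "inj_on nephroid_primitive (ball 0 (sqrt 3))"
proof (rule inj_onI)
  fix x y :: complex
  assume xy: "x \<in> ball 0 (sqrt 3)" "y \<in> ball 0 (sqrt 3)"
    and eq: "nephroid_primitive x = nephroid_primitive y"
  have "(x - y) * (9 - (x * x + x * y + y * y)) = 0"
  proof -
    have "(x - y) * (9 - (x * x + x * y + y * y)) = 9 * ((x - x ^ 3 / 9) - (y - y ^ 3 / 9))"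
      by (simp add: algebra_simps power3_eq_cube)
    also have "\<dots> = 0"
      using eq unfolding nephroid_primitive_def by simp
    finally show ?thesis .
  qed
  moreover have "9 - (x * x + x * y + y * y) \<noteq> 0"
  proof
    assume "9 - (x * x + x * y + y * y) = 0"
    then have "norm (x * x + x * y + y * y) = 9" by simp
    moreover have "norm (x * x + x * y + y * y)
        \<le> norm x * norm x + norm x * norm y + norm y * norm y"
      by (metis norm_mult norm_triangle_le add_mono norm_triangle_ineq order_refl)
    moreover have "norm u * norm v < 3" if "norm u < sqrt 3" "norm v < sqrt 3" for u v :: complex
      using mult_strict_mono'[OF that] by simp
    ultimately show False using xy by (smt (verit) dist_0_norm mem_ball)
  qed
  ultimately show "x = y" by simp
qed

text \<open>In the coordinate \<open>\<zeta> = log z\<close> the function \<open>log (z - z\<^sup>3/3)\<close> has a derivative with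
  positive real part, so along a segment whose image is parallel to the real axis its
  real part increases with \<open>Re \<zeta> = log |z|\<close>: the nephroid is starlike.\<close>

lemma nephroid_starlike:
  fixes a b :: complex and m :: real
  assumes a: "norm a < 1" and b: "norm b = 1" and m: "0 < m"
    and eq: "a - a ^ 3 / 3 = of_real m * (b - b ^ 3 / 3)"
  shows "m < 1"
proof -
  \<comment> \<open>For z = exp \<zeta> this is a logarithm of z - z^3/3. The principal branch of
    \<open>Ln\<close> causes no jump, because its argument has positive real part on the closed left
    half-plane.\<close>
  define F where "F \<zeta> = \<zeta> + Ln (1 - exp (2 * \<zeta>) / 3)" for \<zeta> :: complex
  have Re_pos: "Re (1 - exp (2 * \<zeta>) / 3) > 0" if "Re \<zeta> \<le> 0" for \<zeta>
  proof -
    have "norm (exp (2 * \<zeta>)) \<le> 1" using that by simp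
    then have "Re (exp (2 * \<zeta>)) \<le> 1" using complex_Re_le_cmod order_trans by blast
    then show ?thesis by simp
  qed
  have expF: "exp (F \<zeta>) = exp \<zeta> - exp \<zeta> ^ 3 / 3" if "Re \<zeta> \<le> 0" for \<zeta>
  proof -
    have "1 - exp (2 * \<zeta>) / 3 \<noteq> 0" using Re_pos[OF that] by force
    moreover have "exp (2 * \<zeta>) = exp \<zeta> * exp \<zeta>" by (simp add: exp_double power2_eq_square)
    ultimately show ?thesis
      by (simp add: F_def exp_add power3_eq_cube algebra_simps)
  qed
  have b0: "b \<noteq> 0" using b by auto
  have "b - b ^ 3 / 3 \<noteq> 0"
  proof
    assume "b - b ^ 3 / 3 = 0"
    then have "b ^ 3 = 3 * b" by (metis eq_iff_diff_eq_0 nonzero_mult_div_cancel_left times_divide_eq_right zero_neq_numeral)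
    then have "norm b ^ 3 = 3 * norm b" by (metis norm_power norm_mult norm_numeral)
    then show False using b by simp
  qed
  then have a0: "a \<noteq> 0" using eq m by auto
  define y where "y = Ln b"
  define x where "x = Ln a"
  have Rey: "Re y = 0" and Rex: "Re x < 0"
    using a b a0 b0 by (auto simp: x_def y_def)
  have "exp (F x) = exp (F y + of_real (ln m))"
    using expF[of x] expF[of y] Rex Rey eq a0 b0 m
    by (simp add: x_def y_def exp_add exp_of_real)
  then obtain n :: int where n: "F x = F y + of_real (ln m) + (of_int (2 * n) * pi) * \<i>"
    unfolding exp_eq by auto
  \<comment> \<open>Equal exponentials determine \<open>F x\<close> only up to a multiple of 2 pi i.
    \<open>F\<close> commutes with translation by such multiples, so another logarithm of
    \<open>a\<close> absorbs the discrepancy.\<close>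
  define x' where "x' = x - (of_int (2 * n) * pi) * \<i>"
  have "exp (2 * x') = exp (2 * x)"
    unfolding exp_eq x'_def by (rule exI[of _ "-2*n"]) (simp add: algebra_simps)
  then have "F x' = F x - (of_int (2 * n) * pi) * \<i>"
    by (simp add: F_def) (simp add: x'_def)
  then have Fx': "F x' - F y = of_real (ln m)" using n by simp
  have Rex': "Re x' < 0" using Rex by (simp add: x'_def)
  define d where "d = x' - y"
  have d0: "d \<noteq> 0" and Red: "Re d < 0" using Rex' Rey by (auto simp: d_def)
  \<comment> \<open>The derivative of \<phi> is |d|^2 times the real part of the derivative of
    \<open>F\<close>, and its total increment is \<open>Re d * ln m\<close>. Since
    \<open>Re d < 0\<close>, a positive increment forces \<open>ln m < 0\<close>.\<close>
  define \<phi> where "\<phi> t = Re (cnj d * F (y + of_real t * d))" for t :: real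
  have derF: "(F has_field_derivative 1 - (2 * exp (2 * \<zeta>) / 3) / (1 - exp (2 * \<zeta>) / 3)) (at \<zeta>)"
    if "Re \<zeta> \<le> 0" for \<zeta>
  proof -
    have "1 - exp (2 * \<zeta>) / 3 \<notin> \<real>\<^sub>\<le>\<^sub>0"
      using Re_pos[OF that] by (auto simp: complex_nonpos_Reals_iff)
    moreover have "exp (2 * \<zeta>) \<noteq> 3"
      using Re_pos[OF that] by auto
    ultimately show ?thesis unfolding F_def [abs_def]
      by (auto intro!: derivative_eq_intros simp: divide_simps)
        (simp add: algebra_simps)
  qed
  have der\<phi>: "(\<phi> has_real_derivative
      Re (cnj d * ((1 - (2 * exp (2 * (y + of_real t * d)) / 3)
        / (1 - exp (2 * (y + of_real t * d)) / 3)) * d))) (at t)"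
    if "0 \<le> t" for t
  proof -
    have "Re (y + of_real t * d) \<le> 0"
      using that Red Rey by (simp add: mult_nonneg_nonpos)
    from derF[OF this]
    have "((\<lambda>s. F (y + s * d)) has_field_derivative
        ((1 - (2 * exp (2 * (y + of_real t * d)) / 3)
        / (1 - exp (2 * (y + of_real t * d)) / 3)) * d)) (at (of_real t))"
      by (rule DERIV_chain2) (auto intro!: derivative_eq_intros)
    then have "((\<lambda>s. cnj d * F (y + s * d)) has_field_derivative
        cnj d * ((1 - (2 * exp (2 * (y + of_real t * d)) / 3)
        / (1 - exp (2 * (y + of_real t * d)) / 3)) * d)) (at (of_real t))"
      by (rule DERIV_cmult)
    from has_vector_derivative_real_field[OF this]
    have "((\<lambda>s. cnj d * F (y + of_real s * d)) has_vector_derivative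
        cnj d * ((1 - (2 * exp (2 * (y + of_real t * d)) / 3)
        / (1 - exp (2 * (y + of_real t * d)) / 3)) * d)) (at t)" .
    from has_field_derivative_Re[OF this] show ?thesis
      unfolding \<phi>_def [abs_def] has_real_derivative_iff_has_vector_derivative .
  qed
  \<comment> \<open>Monotonicity from the open interval only: at t = 0 one has E = b^2, so the
    derivative vanishes when b is 1 or -1.\<close>
  have "\<phi> 0 < \<phi> 1"
  proof (rule DERIV_pos_imp_increasing_open[where f = \<phi> and a = 0 and b = 1])
    fix t :: real assume t: "0 < t" "t < 1"
    define E where "E = exp (2 * (y + of_real t * d))"
    have "norm E < 1"
      using t Red Rey by (simp add: E_def mult_pos_neg)
    then have nE: "(Re E)\<^sup>2 + (Im E)\<^sup>2 < 1" and ReE: "Re E < 1"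
      using cmod_power2[of E] abs_square_less_1[of "norm E"] complex_Re_le_cmod[of E] by auto
    have ne: "1 - E / 3 \<noteq> 0" using ReE by (auto simp: complex_eq_iff)
    have "1 - (2 * E / 3) / (1 - E / 3) = (1 - E) / (1 - E / 3)"
      using ne by (simp add: field_simps)
    moreover have "Re ((1 - E) * cnj (1 - E / 3)) > 0"
    proof -
      have "Re ((1 - E) * cnj (1 - E / 3)) = 1 - 4 / 3 * Re E + ((Re E)\<^sup>2 + (Im E)\<^sup>2) / 3"
        by (simp add: power2_eq_square field_simps)
      also have "\<dots> \<ge> 1 - 4 / 3 * Re E + (Re E)\<^sup>2 / 3" by simp
      moreover have "1 - 4 / 3 * Re E + (Re E)\<^sup>2 / 3 = (1 - Re E) * (3 - Re E) / 3"
        by (simp add: power2_eq_square field_simps)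
      ultimately show ?thesis using ReE by (smt (verit) mult_pos_pos divide_pos_pos)
    qed
    ultimately have "Re (1 - (2 * E / 3) / (1 - E / 3)) > 0"
      using Re_complex_div_gt_0 by auto
    moreover have "Re (cnj d * (K * d)) = (norm d)\<^sup>2 * Re K" for K
      unfolding cmod_power2 by (simp add: power2_eq_square algebra_simps)
    ultimately show "\<exists>l. DERIV \<phi> t :> l \<and> l > 0"
      using der\<phi>[of t] t d0 unfolding E_def by (metis less_imp_le mult_pos_pos zero_less_norm_iff zero_less_power)
  next
    show "continuous_on {0..1} \<phi>"
      by (intro continuous_at_imp_continuous_on ballI) (use der\<phi> DERIV_isCont in auto)
  qed auto
  moreover have "\<phi> 1 - \<phi> 0 = Re (cnj d * (F x' - F y))"
    by (simp add: \<phi>_def d_def algebra_simps)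
  ultimately have "0 < Re d * ln m" by (simp add: Fx')
  then have "ln m < 0" using Red by (simp add: zero_less_mult_iff)
  then show ?thesis using m by simp
qed

text \<open>The point z0 is approached along the logarithmic spirals z0 exp (t (-1 + i s)), on which
  Schwarz's lemma gives |f| \<le> exp (-t), with equality at t = 0. Comparing derivatives at t = 0
  yields Re F + s Im F \<ge> 1 for the quotient F = z0 D / f z0. This for every real s leaves only a
  real F with F \<ge> 1.\<close>

lemma Jack_lemma:
  fixes f :: "complex \<Rightarrow> complex"
  assumes hol: "f holomorphic_on ball 0 r" and f0: "f 0 = 0"
    and lt: "\<And>z. norm z < r \<Longrightarrow> norm (f z) < 1"
    and z0: "norm z0 = r" "r > 0" and fz0: "norm (f z0) = 1"
    and der: "(f has_field_derivative D) (at z0)"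
  obtains m :: real where "1 \<le> m" "z0 * D = of_real m * f z0"
proof -
  define F where "F = z0 * D / f z0"
  have fz0': "f z0 \<noteq> 0" using fz0 by auto
  have schwarz: "norm (f z) \<le> norm z / r" if "norm z < r" for z
  proof -
    have "norm (f (of_real r * (z / of_real r))) \<le> norm (z / of_real r)"
    proof (rule Schwarz_Lemma(1))
      show "(\<lambda>z. f (of_real r * z)) holomorphic_on ball 0 1"
        using z0 by (intro holomorphic_on_compose_gen[OF _ hol, unfolded o_def] holomorphic_intros)
          (auto simp: norm_mult)
    qed (use z0 f0 lt that in \<open>auto simp: norm_mult norm_divide\<close>)
    then show ?thesis using z0 by (simp add: norm_divide)
  qed
  have key: "- Re F - s * Im F \<le> - 1" for s :: real
  proof -
    define d where "d = Complex (-1) s"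
    define k where "k t = Re (f (z0 * exp (of_real t * d)) / f z0) - exp (- t)" for t :: real
    have "((\<lambda>t. f (z0 * exp (t * d)) / f z0) has_field_derivative D * (z0 * d) / f z0) (at (of_real 0))"
    proof -
      have "(f has_field_derivative D) (at (z0 * exp (of_real 0 * d)))" using der by simp
      then have "((\<lambda>t. f (z0 * exp (t * d))) has_field_derivative D * (z0 * d)) (at (of_real 0))"
        by (rule DERIV_chain2) (auto intro!: derivative_eq_intros)
      then show ?thesis by (rule DERIV_cdivide)
    qed
    from has_field_derivative_Re[OF has_vector_derivative_real_field[OF this]]
    have "((\<lambda>t. Re (f (z0 * exp (of_real t * d)) / f z0)) has_real_derivative
       Re (D * (z0 * d) / f z0)) (at 0)" .
    moreover have "((\<lambda>t::real. exp (- t)) has_real_derivative - 1) (at 0)"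
      by (auto intro!: derivative_eq_intros)
    ultimately have "(k has_real_derivative Re (D * (z0 * d) / f z0) - - 1) (at 0)"
      unfolding k_def [abs_def] by (rule DERIV_diff)
    moreover have "D * (z0 * d) / f z0 = F * d" by (simp add: F_def)
    moreover have "Re (F * d) = - Re F - s * Im F" by (simp add: d_def)
    ultimately have dk: "(k has_real_derivative - Re F - s * Im F + 1) (at 0)" by simp
    have k0: "k 0 = 0" using fz0' by (simp add: k_def)
    have kle: "k t \<le> 0" if "t > 0" for t
    proof -
      have n: "norm (z0 * exp (of_real t * d)) = r * exp (- t)"
        by (simp add: norm_mult z0 d_def)
      then have "norm (f (z0 * exp (of_real t * d))) \<le> exp (- t)"
        using schwarz[of "z0 * exp (of_real t * d)"] that z0 by simp
      then have "norm (f (z0 * exp (of_real t * d)) / f z0) \<le> exp (- t)"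
        by (simp add: norm_divide fz0)
      then show ?thesis
        using complex_Re_le_cmod[of "f (z0 * exp (of_real t * d)) / f z0"] by (simp add: k_def)
    qed
    have "\<not> 0 < - Re F - s * Im F + 1"
    proof
      assume "0 < - Re F - s * Im F + 1"
      then obtain e where "e > 0" "\<And>h. h > 0 \<Longrightarrow> h < e \<Longrightarrow> k 0 < k (0 + h)"
        using has_real_derivative_pos_inc_right[OF dk] by auto
      then show False using kle[of "e / 2"] k0 by (metis add_0 field_sum_of_halves half_gt_zero less_add_same_cancel1 not_less)
    qed
    then show ?thesis by simp
  qed
  have "Im F = 0"
  proof (rule ccontr)
    assume "Im F \<noteq> 0"
    then show False using key[of "- Re F / Im F"] by simp
  qed
  moreover from this have "Re F \<ge> 1" using key[of 0] by simp
  ultimately have "F = of_real (Re F)" "Re F \<ge> 1" by (auto simp: complex_eq_iff)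
  moreover have "z0 * D = F * f z0" using fz0' by (simp add: F_def)
  ultimately show ?thesis using that by metis
qed

text \<open>\<open>W\<close> is the inverse of H applied to \<open>G\<close>. If |W| first reaches 1
  at z0 with value \<zeta>, then z0 G'(z0) = m (\<zeta> - \<zeta>^3/3) with m \<ge> 1, and the
  equation for \<open>G\<close> makes w - w^3/3, for some |w| < 1, equal to m/c \<ge> 1 times a
  boundary value. Starlikeness forbids this.\<close>

lemma nephroid_primitive_subordination:
  fixes G w :: "complex \<Rightarrow> complex" and c :: real
  assumes holG: "G holomorphic_on ball 0 1" and G0: "G 0 = 0"
    and w: "\<And>z. norm z < 1 \<Longrightarrow> norm (w z) < 1"
    and c: "0 < c" "c \<le> 1"
    and eq: "\<And>z. norm z < 1 \<Longrightarrow> z * deriv G z = of_real c * (w z - w z ^ 3 / 3)"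
  obtains W where "W holomorphic_on ball 0 1" "W 0 = 0"
    "\<And>z. norm z < 1 \<Longrightarrow> norm (W z) < 1"
    "\<And>z. norm z < 1 \<Longrightarrow> G z = nephroid_primitive (W z)"
proof -
  let ?H = nephroid_primitive
  have s3: "1 < sqrt (3::real)" by (simp add: real_less_rsqrt)
  have holH: "?H holomorphic_on S" for S
    using holomorphic_nephroid_primitive[OF holomorphic_on_id[of S]] by (simp add: id_def)
  obtain g where holg: "g holomorphic_on ?H ` ball 0 (sqrt 3)"
    and gH: "\<And>z. z \<in> ball 0 (sqrt 3) \<Longrightarrow> g (?H z) = z"
    using holomorphic_has_inverse[OF holH open_ball inj_on_nephroid_primitive] by metis
  define B where "B = ?H ` ball 0 1"
  \<comment> \<open>\<open>T\<close> is open and contains the image of the closed unit disk, so a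
    boundary value of \<open>B\<close> is still an interior point of the domain of
    \<open>g\<close>.\<close>
  define T where "T = ?H ` ball 0 (sqrt 3)"
  have BT: "B \<subseteq> T" unfolding B_def T_def using s3 by (intro image_mono subset_ball) linarith
  have inj1: "inj_on ?H (ball 0 1)"
    using inj_on_nephroid_primitive by (rule inj_on_subset) (use s3 in \<open>intro subset_ball, linarith\<close>)
  have openB: "open B" unfolding B_def
    by (rule open_mapping_thm3[OF holH open_ball inj1])
  have openT: "open T" unfolding T_def
    by (rule open_mapping_thm3[OF holH open_ball inj_on_nephroid_primitive])
  have contG: "continuous_on (ball 0 1) G" using holG holomorphic_on_imp_continuous_on by blast
  have GB: "G z \<in> B" if "norm z < 1" for z
  proof (rule ccontr)
    assume nz: "G z \<notin> B"
    \<comment> \<open>The points of the closed disk through z whose values have left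
      \<open>B\<close> form a compact set; a point of least modulus in it is the first exit
      point.\<close>
    define C where "C = cball 0 (norm z) \<inter> G -` (- B)"
    have sub: "cball 0 (norm z) \<subseteq> ball (0::complex) 1" using that by auto
    have "closed C" unfolding C_def
      using continuous_on_subset[OF contG sub] openB
      by (intro continuous_closed_preimage) auto
    moreover have "bounded C" using bounded_cball[of 0 "norm z"] by (auto simp: C_def intro: bounded_subset)
    ultimately have "compact C" by (simp add: compact_eq_bounded_closed)
    moreover have "C \<noteq> {}" using nz by (auto simp: C_def)
    ultimately obtain z0 where z0C: "z0 \<in> C" and min: "\<And>y. y \<in> C \<Longrightarrow> norm z0 \<le> norm y"
      using continuous_attains_inf[of C norm] continuous_on_norm_id by metis
    define r where "r = norm z0"
    have z01: "norm z0 < 1" and Gz0: "G z0 \<notin> B" and z0z: "norm z0 \<le> norm z"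
      using z0C that by (auto simp: C_def)
    have inside: "G y \<in> B" if "norm y < r" for y
      using min[of y] that z0z by (auto simp: C_def r_def)
    have "0 \<in> B" unfolding B_def by (rule image_eqI[of _ _ 0]) auto
    then have "z0 \<noteq> 0" using Gz0 G0 by metis
    then have r: "r > 0" "r < 1" using z01 by (auto simp: r_def)
    have "z0 \<in> closure (ball 0 r)" using r by (simp add: r_def)
    moreover have "G ` closure (ball 0 r) \<subseteq> closure B"
    proof (rule image_closure_subset)
      show "continuous_on (closure (ball 0 r)) G"
        using contG by (rule continuous_on_subset) (use r in auto)
    qed (use inside closure_subset[of B] in auto)
    ultimately have "G z0 \<in> closure B" by auto
    moreover have "closure B \<subseteq> ?H ` cball 0 1"
    proof (rule closure_minimal)
      show "closed (?H ` cball 0 1)"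
        by (intro compact_imp_closed compact_continuous_image holomorphic_on_imp_continuous_on holH) auto
    qed (auto simp: B_def)
    ultimately obtain \<zeta> where \<zeta>: "norm \<zeta> \<le> 1" "G z0 = ?H \<zeta>" by auto
    then have n\<zeta>: "norm \<zeta> = 1" using Gz0 by (force simp: B_def)
    then have \<zeta>3: "\<zeta> \<in> ball 0 (sqrt 3)" using s3 by simp
    have GT: "G z0 \<in> T" using \<zeta> \<zeta>3 by (auto simp: T_def)
    have gz0: "g (G z0) = \<zeta>" using \<zeta> \<zeta>3 gH by simp
    have derG: "(G has_field_derivative deriv G z0) (at z0)"
      using holG z01 by (intro holomorphic_derivI[of _ "ball 0 1"]) auto
    have derg: "(g has_field_derivative deriv g (G z0)) (at (G z0))"
      using holg openT GT by (intro holomorphic_derivI[of _ T]) (auto simp: T_def)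
    define D where "D = deriv g (G z0) * deriv G z0"
    have derW: "((\<lambda>y. g (G y)) has_field_derivative D) (at z0)"
      unfolding D_def by (rule DERIV_chain2[OF derg derG])
    obtain m where m: "1 \<le> m" "z0 * D = of_real m * g (G z0)"
    proof (rule Jack_lemma[of "\<lambda>y. g (G y)" r z0 D])
      have "g holomorphic_on T" using holg by (simp add: T_def)
      then show "(\<lambda>y. g (G y)) holomorphic_on ball 0 r"
        using holG r inside BT
        by (intro holomorphic_on_compose_gen[where g = g and f = G, unfolded o_def])
           (auto intro: holomorphic_on_subset)
      show "g (G 0) = 0" using gH[of 0] by (simp add: G0)
      show "norm (g (G y)) < 1" if "norm y < r" for y
      proof -
        from inside[OF that] obtain x where x: "norm x < 1" "G y = ?H x" by (auto simp: B_def)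
        then have "g (G y) = x" using gH[of x] s3 by simp
        then show ?thesis using x by simp
      qed
      show "norm (g (G z0)) = 1" by (simp add: gz0 n\<zeta>)
    qed (use derW r in \<open>auto simp: r_def\<close>)
    have "((\<lambda>y. ?H (g y)) has_field_derivative (1 - \<zeta>\<^sup>2 / 3) * deriv g (G z0)) (at (G z0))"
      using DERIV_chain2[OF has_field_derivative_nephroid_primitive derg] gz0 by simp
    moreover have "((\<lambda>y. ?H (g y)) has_field_derivative 1) (at (G z0))"
    proof (rule has_field_derivative_transform_within_open[OF DERIV_ident openT GT])
      show "x = ?H (g x)" if "x \<in> T" for x using that gH by (auto simp: T_def)
    qed
    ultimately have one: "(1 - \<zeta>\<^sup>2 / 3) * deriv g (G z0) = 1" by (rule DERIV_unique)
    have "z0 * deriv G z0 = (1 - \<zeta>\<^sup>2 / 3) * (z0 * D)"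
    proof -
      have "(1 - \<zeta>\<^sup>2 / 3) * (z0 * D) = (1 - \<zeta>\<^sup>2 / 3) * deriv g (G z0) * (z0 * deriv G z0)"
        by (simp only: D_def mult_ac)
      then show ?thesis by (simp only: one mult_1)
    qed
    also have "\<dots> = of_real m * (\<zeta> - \<zeta> ^ 3 / 3)"
      unfolding m gz0 by (simp add: power2_eq_square power3_eq_cube algebra_simps)
    finally have "of_real c * (w z0 - w z0 ^ 3 / 3) = of_real m * (\<zeta> - \<zeta> ^ 3 / 3)"
      using eq[OF z01] by simp
    then have "w z0 - w z0 ^ 3 / 3 = of_real (m / c) * (\<zeta> - \<zeta> ^ 3 / 3)"
      using c by (simp add: field_simps)
    then have "m / c < 1"
      using nephroid_starlike[OF w[OF z01] n\<zeta>, of "m / c"] m c by simp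
    then show False using m c by (simp add: field_simps)
  qed
  have "g holomorphic_on T" using holg by (simp add: T_def)
  then have "(\<lambda>y. g (G y)) holomorphic_on ball 0 1"
    using holG GB BT
    by (intro holomorphic_on_compose_gen[where g = g and f = G, unfolded o_def]) auto
  moreover have "g (G 0) = 0" using gH[of 0] by (simp add: G0)
  moreover have "norm (g (G z)) < 1 \<and> G z = ?H (g (G z))" if "norm z < 1" for z
  proof -
    from GB[OF that] obtain x where x: "norm x < 1" "G z = ?H x" by (auto simp: B_def)
    then have "g (G z) = x" using gH[of x] s3 by simp
    then show ?thesis using x by simp
  qed
  ultimately show ?thesis using that by blast
qed

subsection \<open>The extremal function\<close>

lemma subordinateE:
  assumes "subordinate f g"
  obtains w where "f holomorphic_on ball 0 1" "g holomorphic_on ball 0 1"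
    "w holomorphic_on ball 0 1" "w 0 = 0"
    "\<And>z. norm z < 1 \<Longrightarrow> norm (w z) < 1" "\<And>z. norm z < 1 \<Longrightarrow> f z = g (w z)"
proof -
  obtain w where "w holomorphic_on ball 0 1" "w 0 = 0"
    "\<forall>z\<in>ball 0 1. norm (w z) < 1" "\<forall>z\<in>ball 0 1. f z = g (w z)"
    and "f holomorphic_on ball 0 1" "g holomorphic_on ball 0 1"
    using assms unfolding subordinate_def by auto
  then show ?thesis by (intro that[of w]) simp_all
qed

lemma subordinateI:
  assumes "f holomorphic_on ball 0 1" "g holomorphic_on ball 0 1"
    "w holomorphic_on ball 0 1" "w 0 = 0"
    "\<And>z. norm z < 1 \<Longrightarrow> norm (w z) < 1" "\<And>z. norm z < 1 \<Longrightarrow> f z = g (w z)"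
  shows "subordinate f g"
  unfolding subordinate_def by (intro conjI exI[of _ w] ballI) (simp_all add: assms(1-5) assms(6)[symmetric])

section \<open>Size of the range of the nephroid primitive\<close>

lemma nephroid_primitive_Re_Im:
  "Re (nephroid_primitive z) = Re z - Re z ^ 3 / 9 + Re z * (Im z)\<^sup>2 / 3"
  "Im (nephroid_primitive z) = Im z - (Re z)\<^sup>2 * Im z / 3 + Im z ^ 3 / 9"
  by (simp_all add: nephroid_primitive_def power3_eq_cube power2_eq_square field_simps)

text \<open>The radius is the limit at i and -i, where the two terms of H have the same
  direction.\<close>

lemma norm_nephroid_primitive_less:
  assumes "norm z < 1" shows "norm (nephroid_primitive z) < 10 / 9"
proof -
  have "norm (nephroid_primitive z) \<le> norm z + norm z ^ 3 / 9"
    using norm_triangle_ineq4[of z "z ^ 3 / 9"]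
    by (simp add: nephroid_primitive_def norm_divide norm_power)
  also have "norm z ^ 3 \<le> 1" using assms by (simp add: power_le_one)
  finally show ?thesis using assms by simp
qed

text \<open>Enlarging the imaginary part until z lies on the unit circle increases the real part of
  H; the cubic is the boundary value in terms of \<open>Re z\<close>.\<close>

lemma Re_nephroid_primitive_le:
  assumes z: "norm z < 1" and x: "0 \<le> Re z"
  shows "Re (nephroid_primitive z) \<le> 4 / 3 * Re z - 4 / 9 * Re z ^ 3"
proof -
  have "(Re z)\<^sup>2 + (Im z)\<^sup>2 \<le> 1"
    using z cmod_power2[of z] by (smt (verit) norm_ge_zero power_le_one)
  then have "Re z * (Im z)\<^sup>2 \<le> Re z * (1 - (Re z)\<^sup>2)"
    using x by (intro mult_left_mono) auto
  then show ?thesis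
    by (simp add: nephroid_primitive_Re_Im power2_eq_square power3_eq_cube algebra_simps)
qed

lemma abs_Re_nephroid_primitive_less:
  assumes "norm z < 1" shows "\<bar>Re (nephroid_primitive z)\<bar> < 8 / 9"
proof -
  have *: "Re (nephroid_primitive z) < 8 / 9" if "norm z < 1" for z
  proof (cases "0 \<le> Re z")
    case True
    have "Re z < 1" using that complex_Re_le_cmod[of z] by linarith
    \<comment> \<open>With x = Re z, 8/9 minus the cubic bound is 4/9 times this product; the double
      zero at x = 1 is the contact with the line Re = 8/9.\<close>
    then have "0 < (1 - Re z)\<^sup>2 * (2 + Re z)" using True by (intro mult_pos_pos) auto
    then have "4 / 3 * Re z - 4 / 9 * Re z ^ 3 < 8 / 9"
      by (simp add: power2_eq_square power3_eq_cube algebra_simps)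
    then show ?thesis using Re_nephroid_primitive_le[OF that True] by simp
  next
    case False
    have "\<bar>Re z\<bar> \<le> 1" using that abs_Re_le_cmod[of z] by linarith
    then have "(Re z)\<^sup>2 \<le> 1" by (simp add: abs_square_le_1)
    then have "Re z * (1 - (Re z)\<^sup>2 / 9 + (Im z)\<^sup>2 / 3) \<le> 0"
      using False by (intro mult_nonpos_nonneg) (auto intro: add_nonneg_nonneg)
    then show ?thesis
      by (simp add: nephroid_primitive_Re_Im power2_eq_square power3_eq_cube algebra_simps)
  qed
  have "nephroid_primitive (- z) = - nephroid_primitive z"
    by (simp add: nephroid_primitive_def)
  then show ?thesis using *[of z] *[of "- z"] assms by simp
qed

lemma norm_quotient_less_1:
  assumes "10 / 9 \<le> b" "norm z < 1"
  shows "norm (nephroid_primitive z / of_real b) < 1"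
  using norm_nephroid_primitive_less[OF assms(2)] assms(1) by (simp add: norm_divide)

lemma extremal_denom_nonzero:
  assumes "10 / 9 \<le> b" "norm z < 1"
  shows "1 - nephroid_primitive z / of_real b \<noteq> 0"
  using norm_quotient_less_1[OF assms] by force

lemma holomorphic_extremal:
  assumes "10 / 9 \<le> b"
  shows "extremal b holomorphic_on ball 0 1"
  unfolding extremal_def [abs_def]
proof (rule holomorphic_on_divide[OF holomorphic_on_const])
  show "(\<lambda>z. 1 - nephroid_primitive z / of_real b) holomorphic_on ball 0 1"
    using assms by (intro holomorphic_intros) auto
qed (use extremal_denom_nonzero[OF assms] in simp)

lemma extremal_0 [simp]: "extremal b 0 = 1"
  by (simp add: extremal_def)

text \<open>The map u to 1/(1 - u) carries the unit disk onto this half-plane. The estimate keeps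
  the principal square roots and logarithms analytic in the inverses of the majorants.\<close>

lemma Re_extremal_gt_half:
  assumes "10 / 9 \<le> b" "norm z < 1"
  shows "Re (extremal b z) > 1 / 2"
proof -
  define u where "u = nephroid_primitive z / of_real b"
  have u: "norm u < 1" using norm_quotient_less_1[OF assms] by (simp add: u_def)
  have "(Re u)\<^sup>2 + (Im u)\<^sup>2 < 1"
    using u cmod_power2[of u] abs_square_less_1[of "norm u"] by simp
  moreover have "Re u < 1" using u complex_Re_le_cmod[of u] by linarith
  then have "0 < (1 - Re u)\<^sup>2 + (Im u)\<^sup>2" by (intro add_pos_nonneg) auto
  moreover have "Re (extremal b z) = (1 - Re u) / ((1 - Re u)\<^sup>2 + (Im u)\<^sup>2)"
    by (simp add: extremal_def u_def[symmetric] Re_divide)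
  ultimately show ?thesis
    by (simp add: less_divide_eq) (simp add: power2_eq_square algebra_simps)
qed

text \<open>At a zero of \<open>p\<close> the totalised quotient \<open>z p'(z) / p(z)\<^sup>2\<close> has the junk value \<open>0\<close>, but its
  continuity still gives \<open>z p' = L p\<^sup>2\<close> there, a linear equation for \<open>p\<close> whose only solution
  vanishing at a point is \<open>0\<close>.\<close>

lemma zero_free:
  fixes p L :: "complex \<Rightarrow> complex"
  assumes hol: "p holomorphic_on ball 0 1" and p0: "p 0 \<noteq> 0"
    and holL: "L holomorphic_on ball 0 1"
    and eq: "\<And>z. norm z < 1 \<Longrightarrow> p z \<noteq> 0 \<Longrightarrow> z * deriv p z = L z * (p z)\<^sup>2"
    and z: "norm z < 1"
  shows "p z \<noteq> 0"
proof
  assume pz: "p z = 0"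
  have holp': "deriv p holomorphic_on ball 0 1" using hol by (intro holomorphic_deriv) auto
  have all: "y * deriv p y = L y * (p y)\<^sup>2" if y: "norm y < 1" for y
  proof (cases "p y = 0")
    case True
    obtain r where r: "0 < r" "ball y r \<subseteq> ball 0 1" "\<And>x. x \<in> ball y r - {y} \<Longrightarrow> p x \<noteq> 0"
      using isolated_zeros[OF hol open_ball connected_ball, of y 0] y p0 True
      by (metis (no_types, lifting) centre_in_ball dist_0_norm mem_ball zero_less_one)
    define \<Phi> where "\<Phi> x = x * deriv p x - L x * (p x)\<^sup>2" for x
    have "continuous_on (ball 0 1) \<Phi>"
      unfolding \<Phi>_def
      by (intro continuous_intros holomorphic_on_imp_continuous_on hol holL holp')
    then have "isCont \<Phi> y" using y by (simp add: continuous_on_eq_continuous_at)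
    then have "\<Phi> \<midarrow>y\<rightarrow> \<Phi> y" by (simp add: isCont_def)
    moreover have "\<Phi> \<midarrow>y\<rightarrow> 0"
    proof (rule Lim_transform_within[OF tendsto_const r(1)])
      fix x assume "0 < dist x y" "dist x y < r"
      then have "x \<in> ball y r - {y}" by (auto simp: dist_commute)
      then have "p x \<noteq> 0" "norm x < 1" using r by auto
      then show "0 = \<Phi> x" using eq by (simp add: \<Phi>_def)
    qed
    ultimately have "\<Phi> y = 0" by (rule LIM_unique)
    then show ?thesis by (simp add: \<Phi>_def)
  next
    case False
    then show ?thesis by (rule eq[OF y])
  qed
  have z0: "z \<noteq> 0" using pz p0 by auto
  \<comment> \<open>On \<open>U\<close> the equation reads p' = (L p / y) p and is treated as linear
    with coefficient L p / y. The disk is convex, so the coefficient has a primitive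
    \<open>F\<close> and exp (-F) is an integrating factor; it is chosen small enough to leave out
    the singularity at 0.\<close>
  define U where "U = ball 0 1 \<inter> ball z (norm z)"
  have U: "open U" "convex U" "z \<in> U" "U \<subseteq> ball 0 1" "0 \<notin> U"
    using z z0 by (auto simp: U_def intro: convex_Int open_Int)
  have "(\<lambda>y. L y * p y / y) holomorphic_on U"
    using U by (intro holomorphic_intros holomorphic_on_subset[OF hol] holomorphic_on_subset[OF holL]) auto
  then obtain F where F: "\<And>y. y \<in> U \<Longrightarrow> (F has_field_derivative L y * p y / y) (at y)"
  proof (rule holomorphic_convex_primitive'[OF U(2,1)])
    fix g assume g: "\<And>y. y \<in> U \<Longrightarrow> (g has_field_derivative L y * p y / y) (at y within U)"
    show thesis
      by (rule that[of g]) (use g at_within_open[OF _ U(1)] in force)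
  qed
  have "((\<lambda>y. p y * exp (- F y)) has_field_derivative 0) (at y within U)" if y: "y \<in> U" for y
  proof -
    have "y \<in> ball 0 1" "y \<noteq> 0" using y U(4,5) by blast+
    then have y1: "norm y < 1" "y \<noteq> 0" by simp_all
    have "(p has_field_derivative deriv p y) (at y)"
      using hol y1 by (intro holomorphic_derivI[of _ "ball 0 1"]) auto
    moreover have "deriv p y = L y * p y / y * p y"
    proof -
      have "deriv p y * y = L y * p y * p y"
        using all[OF y1(1)] by (simp add: power2_eq_square mult_ac)
      then show ?thesis using y1(2) by (simp add: eq_divide_eq)
    qed
    ultimately have "((\<lambda>y. p y * exp (- F y)) has_field_derivative 0) (at y)"
      using F[OF y] by (auto intro!: derivative_eq_intros)
    then show ?thesis by (rule has_field_derivative_at_within)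
  qed
  then obtain c where c: "\<And>y. y \<in> U \<Longrightarrow> p y * exp (- F y) = c"
    using has_field_derivative_zero_constant[OF U(2), of "\<lambda>y. p y * exp (- F y)"] by auto
  have "c = 0" using c[OF U(3)] pz by simp
  then have "p y = 0" if "y \<in> U" for y using c[OF that] by simp
  then have "p 0 = 0"
    using analytic_continuation_open[OF U(1) open_ball _ connected_ball U(4) hol holomorphic_on_const, of 0 0]
      U(3) by auto
  then show False using p0 by simp
qed

section \<open>From the hypothesis to the extremal function\<close>

text \<open>Since (1 - 1/p)' = p'/p^2, the hypothesis is a statement about z G' for G = b (1 - 1/p).
  Scaling by \<open>b\<close> instead of \<beta> moves the excess of \<beta> into the factor
  b/\<beta> \<le> 1, so one extremal function serves all \<beta> \<ge> b.\<close>

lemma nephroid_hyp_imp_extremal: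
  assumes hyp: "nephroid_hyp \<beta> p" and b: "0 < b" "b \<le> \<beta>"
  obtains W where "W holomorphic_on ball 0 1" "W 0 = 0"
    "\<And>z. norm z < 1 \<Longrightarrow> norm (W z) < 1"
    "\<And>z. norm z < 1 \<Longrightarrow> p z = extremal b (W z)"
proof -
  define L where "L z = 1 + of_real \<beta> * (z * deriv p z / (p z)\<^sup>2)" for z
  have holp: "p holomorphic_on ball 0 1" and p0: "p 0 = 1" and sub: "subordinate L phi_Ne"
    using hyp by (auto simp: nephroid_hyp_def L_def [abs_def])
  from sub obtain w where holL: "L holomorphic_on ball 0 1"
    and w: "\<And>z. norm z < 1 \<Longrightarrow> norm (w z) < 1"
    and Lw: "\<And>z. norm z < 1 \<Longrightarrow> L z = phi_Ne (w z)"
    by (rule subordinateE) (rule that; blast)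
  have \<beta>: "0 < \<beta>" using b by simp
  have nz: "p z \<noteq> 0" if "norm z < 1" for z
  proof (rule zero_free[OF holp _ _ _ that])
    show "(\<lambda>z. (L z - 1) / of_real \<beta>) holomorphic_on ball 0 1"
      using \<beta> by (intro holomorphic_intros holL) auto
  qed (use p0 \<beta> in \<open>auto simp: L_def\<close>)
  define G where "G z = of_real b * (1 - 1 / p z)" for z
  have holG: "G holomorphic_on ball 0 1"
    unfolding G_def [abs_def] using nz by (intro holomorphic_intros holp) auto
  have derivG: "z * deriv G z = of_real (b / \<beta>) * (w z - w z ^ 3 / 3)" if z: "norm z < 1" for z
  proof -
    have "(p has_field_derivative deriv p z) (at z)"
      using holp z by (intro holomorphic_derivI[of _ "ball 0 1"]) auto
    then have "(G has_field_derivative of_real b * (deriv p z / (p z)\<^sup>2)) (at z)"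
      unfolding G_def [abs_def] using nz[OF z]
      by (auto intro!: derivative_eq_intros simp: power2_eq_square)
    then have "deriv G z = of_real b * (deriv p z / (p z)\<^sup>2)" by (rule DERIV_imp_deriv)
    moreover have "of_real \<beta> * (z * deriv p z / (p z)\<^sup>2) = w z - w z ^ 3 / 3"
      using Lw[OF z] by (simp add: L_def phi_Ne_def)
    then have "z * deriv p z / (p z)\<^sup>2 = (w z - w z ^ 3 / 3) / of_real \<beta>"
      using \<beta> by (simp add: eq_divide_eq mult_ac)
    ultimately have "z * deriv G z = of_real b * ((w z - w z ^ 3 / 3) / of_real \<beta>)"
      by (metis mult.left_commute times_divide_eq_right)
    then show ?thesis by simp
  qed
  obtain W where W: "W holomorphic_on ball 0 1" "W 0 = 0"
    "\<And>z. norm z < 1 \<Longrightarrow> norm (W z) < 1"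
    "\<And>z. norm z < 1 \<Longrightarrow> G z = nephroid_primitive (W z)"
    using nephroid_primitive_subordination[OF holG _ w _ _ derivG] b p0 by (auto simp: G_def)
  have "p z = extremal b (W z)" if z: "norm z < 1" for z
    using W(4)[OF z, symmetric] nz[OF z] b by (simp add: extremal_def G_def)
  with W show ?thesis using that by blast
qed

lemma valid_boundI:
  assumes b: "0 < b" and sub: "subordinate (extremal b) \<phi>"
  shows "valid_bound \<phi> b"
  unfolding valid_bound_def
proof (intro allI impI, elim conjE)
  fix \<beta> p assume hyp: "nephroid_hyp \<beta> p" and "b \<le> \<beta>"
  obtain W where W: "W holomorphic_on ball 0 1" "W 0 = 0"
    "\<And>z. norm z < 1 \<Longrightarrow> norm (W z) < 1"
    "\<And>z. norm z < 1 \<Longrightarrow> p z = extremal b (W z)"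
    by (rule nephroid_hyp_imp_extremal[OF hyp b \<open>b \<le> \<beta>\<close>]) (rule that; blast)
  from sub obtain f where f: "\<phi> holomorphic_on ball 0 1" "f holomorphic_on ball 0 1" "f 0 = 0"
    "\<And>z. norm z < 1 \<Longrightarrow> norm (f z) < 1" "\<And>z. norm z < 1 \<Longrightarrow> extremal b z = \<phi> (f z)"
    by (rule subordinateE) (rule that; blast)
  show "subordinate p \<phi>"
  proof (rule subordinateI)
    show "p holomorphic_on ball 0 1" using hyp by (simp add: nephroid_hyp_def)
    show "(\<lambda>z. f (W z)) holomorphic_on ball 0 1"
      by (rule holomorphic_on_compose_gen[OF W(1) f(2), unfolded o_def]) (use W(3) in auto)
    show "f (W 0) = 0" by (simp add: W(2) f(3))
    show "norm (f (W z)) < 1" "p z = \<phi> (f (W z))" if "norm z < 1" for z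
      by (simp_all only: f(4)[OF W(3)[OF that]] W(4)[OF that] f(5)[OF W(3)[OF that]])
  qed (rule f(1))
qed

text \<open>The modulus of \<open>f\<close> cannot cross \<open>1\<close>, because the image of the circle under \<open>\<phi>\<close> misses the
  range of the extremal function.\<close>

lemma extremal_subordinateI:
  assumes hol\<phi>: "\<phi> holomorphic_on ball 0 1" and b: "10 / 9 \<le> b"
    and holf: "f holomorphic_on ball 0 1" and f0: "f 0 = 0"
    and f: "\<And>z. norm z < 1 \<Longrightarrow> \<phi> (f z) = extremal b z"
    and circle: "\<And>\<zeta>. norm \<zeta> = 1 \<Longrightarrow>
       10 / 9 * norm (\<phi> \<zeta>) \<le> b * norm (\<phi> \<zeta> - 1) \<or> 8 / 9 \<le> \<bar>b * (1 - Re (1 / \<phi> \<zeta>))\<bar> \<or>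
       (\<forall>z. norm z < 1 \<longrightarrow> nephroid_primitive z \<noteq> of_real b * (1 - 1 / \<phi> \<zeta>))"
  shows "subordinate (extremal b) \<phi>"
proof -
  \<comment> \<open>The point b (1 - 1/\<phi>(f z)) equals H z. The alternatives in
    \<open>circle\<close> say in turn that for |\<zeta>| = 1 the point b (1 - 1/\<phi>(\<zeta>)) has
    modulus at least 10/9, that it lies outside the strip, or outright that it is no value of H on
    the disk.\<close>
  have ne1: "norm (f z) \<noteq> 1" if z: "norm z < 1" for z
  proof
    assume 1: "norm (f z) = 1"
    have ne: "1 - nephroid_primitive z / of_real b \<noteq> 0"
      using extremal_denom_nonzero[OF b z] .
    have u: "nephroid_primitive z = of_real b * (1 - 1 / \<phi> (f z))" and "\<phi> (f z) \<noteq> 0"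
      using ne b unfolding f[OF z] extremal_def by simp_all
    then have "nephroid_primitive z * \<phi> (f z) = of_real b * (\<phi> (f z) - 1)"
      by (simp add: field_simps)
    then have "norm (nephroid_primitive z) * norm (\<phi> (f z)) = b * norm (\<phi> (f z) - 1)"
      using b by (simp flip: norm_mult) (simp add: norm_mult)
    moreover have "norm (nephroid_primitive z) * norm (\<phi> (f z)) < 10 / 9 * norm (\<phi> (f z))"
      using norm_nephroid_primitive_less[OF z] \<open>\<phi> (f z) \<noteq> 0\<close> by simp
    moreover have "Re (nephroid_primitive z) = b * (1 - Re (1 / \<phi> (f z)))"
      unfolding u by simp
    ultimately show False
      using circle[OF 1] abs_Re_nephroid_primitive_less[OF z] u z by force
  qed
  have "norm (f z) < 1" if z: "norm z < 1" for z
  proof (rule ccontr)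
    assume ge: "\<not> norm (f z) < 1"
    have conn: "connected ((\<lambda>z. norm (f z)) ` ball 0 1)"
      by (intro connected_continuous_image continuous_intros holomorphic_on_imp_continuous_on holf
            connected_ball)
    have "norm (f 0) \<in> (\<lambda>z. norm (f z)) ` ball 0 1"
      by (rule imageI) simp
    moreover have "norm (f z) \<in> (\<lambda>z. norm (f z)) ` ball 0 1"
      using z by (intro imageI) simp
    moreover have "norm (f 0) \<le> 1" "1 \<le> norm (f z)" using ge f0 by simp_all
    ultimately have "1 \<in> (\<lambda>z. norm (f z)) ` ball 0 1"
      by (rule connectedD_interval[OF conn])
    then show False using ne1 by auto
  qed
  then show ?thesis
    using f by (intro subordinateI[OF holomorphic_extremal[OF b] hol\<phi> holf f0]) simp_all
qed

section \<open>Sharpness\<close>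

text \<open>The identity serves as the Schwarz function: b (1 - 1/p) = H gives b z p'/p^2 = z -
  z^3/3. Extremal functions are therefore admissible test functions for any smaller bound.\<close>

lemma nephroid_hyp_extremal:
  assumes b: "10 / 9 \<le> b"
  shows "nephroid_hyp b (extremal b)"
proof -
  have *: "1 + of_real b * (z * deriv (extremal b) z / (extremal b z)\<^sup>2) = phi_Ne z"
    if z: "norm z < 1" for z
  proof -
    let ?u = "1 - nephroid_primitive z / of_real b"
    have ne: "?u \<noteq> 0" using extremal_denom_nonzero[OF b z] .
    have "((\<lambda>z. 1 - nephroid_primitive z / of_real b) has_field_derivative
        - ((1 - z\<^sup>2 / 3) / of_real b)) (at z)"
      using b by (auto intro!: derivative_eq_intros has_field_derivative_nephroid_primitive)
    from DERIV_inverse'[OF this ne]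
    have "(extremal b has_field_derivative ((1 - z\<^sup>2 / 3) / of_real b) * (extremal b z)\<^sup>2) (at z)"
      by (simp add: extremal_def [abs_def] inverse_eq_divide power2_eq_square mult_ac)
    then have "deriv (extremal b) z = ((1 - z\<^sup>2 / 3) / of_real b) * (extremal b z)\<^sup>2"
      by (rule DERIV_imp_deriv)
    moreover have "extremal b z \<noteq> 0" using ne by (simp add: extremal_def)
    ultimately have "deriv (extremal b) z / (extremal b z)\<^sup>2 = (1 - z\<^sup>2 / 3) / of_real b"
      by simp
    then have "of_real b * (z * (deriv (extremal b) z / (extremal b z)\<^sup>2)) = z * (1 - z\<^sup>2 / 3)"
      using b by simp
    then show ?thesis
      by (simp add: phi_Ne_def power2_eq_square power3_eq_cube algebra_simps)
  qed
  have holN: "phi_Ne holomorphic_on ball 0 1"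
    unfolding phi_Ne_def [abs_def] by (intro holomorphic_intros) auto
  then have "(\<lambda>z. 1 + of_real b * (z * deriv (extremal b) z / (extremal b z)\<^sup>2)) holomorphic_on ball 0 1"
    by (rule holomorphic_transform) (rule *[symmetric], simp)
  then have "subordinate (\<lambda>z. 1 + of_real b * (z * deriv (extremal b) z / (extremal b z)\<^sup>2)) phi_Ne"
    by (rule subordinateI[OF _ holN holomorphic_on_ident]) (simp, assumption, erule *)
  then show ?thesis
    by (simp add: nephroid_hyp_def holomorphic_extremal[OF b])
qed

lemma extremal_of_real: "extremal b (of_real r) = of_real (1 / (1 - (r - r ^ 3 / 9) / b))"
  by (simp add: extremal_def nephroid_primitive_def)

lemma best_boundI:
  assumes b: "10 / 9 < b" and sub: "subordinate (extremal b) \<phi>"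
    and sharp: "\<And>\<beta>. 10 / 9 < \<beta> \<Longrightarrow> \<beta> < b \<Longrightarrow>
       \<exists>r. \<bar>r\<bar> < 1 \<and> (\<forall>w. norm w < 1 \<longrightarrow> \<phi> w \<noteq> of_real (1 / (1 - (r - r ^ 3 / 9) / \<beta>)))"
  shows "best_bound \<phi> b"
  unfolding best_bound_def
proof (intro conjI allI impI notI)
  show "valid_bound \<phi> b" using valid_boundI[OF _ sub] b by simp
next
  fix b' assume b': "b' < b" and valid: "valid_bound \<phi> b'"
  \<comment> \<open>Being above b' makes \<beta> admissible for the supposed smaller bound; being
    above 10/9 makes \<open>extremal \<beta>\<close> analytic on the disk.\<close>
  obtain \<beta> where \<beta>: "max b' (10 / 9) < \<beta>" "\<beta> < b" using dense[of "max b' (10/9)" b] b b' by auto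
  then have "subordinate (extremal \<beta>) \<phi>"
    using valid nephroid_hyp_extremal[of \<beta>] unfolding valid_bound_def by (meson less_imp_le max_less_iff_conj)
  then obtain w where w: "\<And>z. norm z < 1 \<Longrightarrow> norm (w z) < 1"
    "\<And>z. norm z < 1 \<Longrightarrow> extremal \<beta> z = \<phi> (w z)"
    by (rule subordinateE) (rule that; blast)
  obtain r where r: "\<bar>r\<bar> < 1" "\<forall>w. norm w < 1 \<longrightarrow> \<phi> w \<noteq> of_real (1 / (1 - (r - r ^ 3 / 9) / \<beta>))"
    using sharp[of \<beta>] \<beta> by auto
  have r1: "norm (complex_of_real r) < 1" using r(1) by simp
  show False
    using r(2) w(1)[OF r1] w(2)[OF r1, unfolded extremal_of_real, symmetric] by blast
qed

text \<open>The second assumption is \<open>M < 1 / (1 - 8 / (9 * \<beta>))\<close> with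
  denominators cleared: the radial limit of the extremal function at 1 exceeds \<open>M\<close>, and
  so do values at real points just before it.\<close>

lemma extremal_real_near_1:
  assumes \<beta>: "8 / 9 < \<beta>" "\<beta> * (9 * (M - 1)) < 8 * M" and M: "1 < M"
  obtains r :: real where "\<bar>r\<bar> < 1" "M < 1 / (1 - (r - r ^ 3 / 9) / \<beta>)"
proof -
  have "((\<lambda>r::real. 1 / (1 - (r - r ^ 3 / 9) / \<beta>)) \<longlongrightarrow> 1 / (1 - (1 - 1 ^ 3 / 9) / \<beta>)) (at_left 1)"
    using \<beta> by (intro tendsto_intros) auto
  moreover have "M < 1 / (1 - (1 - 1 ^ 3 / 9) / \<beta>)"
    using \<beta> by (simp add: field_simps)
  ultimately have "\<forall>\<^sub>F r::real in at_left 1. M < 1 / (1 - (r - r ^ 3 / 9) / \<beta>)"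
    by (rule order_tendstoD)
  moreover have "\<forall>\<^sub>F r::real in at_left 1. r \<in> {0<..<1}"
    by (rule eventually_at_left_real) simp
  ultimately have "\<forall>\<^sub>F r::real in at_left 1. \<bar>r\<bar> < 1 \<and> M < 1 / (1 - (r - r ^ 3 / 9) / \<beta>)"
    by eventually_elim auto
  then show ?thesis using eventually_happens'[OF trivial_limit_at_left_real] that by blast
qed

text \<open>This covers the majorants whose critical value is M = \<phi>(1). The formula for
  \<open>b\<close> solves b (1 - 1/M) = 8/9, and M < 5 is the same as 10/9 < b. The half-plane Re
  \<ge> 8/9 becomes \<open>Re (1 / \<phi> \<zeta>) \<le> 1 / M\<close>. For sharpness only real
  values of \<phi> are compared with \<open>M\<close>, since the extremal function exceeds
  \<open>M\<close> at real points.\<close>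

lemma best_boundI_right:
  fixes b M :: real
  assumes M: "1 < M" "M < 5" and b: "b = 8 * M / (9 * (M - 1))"
    and hol\<phi>: "\<phi> holomorphic_on ball 0 1"
    and holf: "f holomorphic_on ball 0 1" and f0: "f 0 = 0"
    and f: "\<And>z. norm z < 1 \<Longrightarrow> \<phi> (f z) = extremal b z"
    and circle: "\<And>\<zeta>. norm \<zeta> = 1 \<Longrightarrow>
       10 / 9 * norm (\<phi> \<zeta>) \<le> b * norm (\<phi> \<zeta> - 1) \<or> Re (1 / \<phi> \<zeta>) \<le> 1 / M \<or>
       (\<forall>z. norm z < 1 \<longrightarrow> nephroid_primitive z \<noteq> of_real b * (1 - 1 / \<phi> \<zeta>))"
    and le: "\<And>w. norm w < 1 \<Longrightarrow> Im (\<phi> w) = 0 \<Longrightarrow> Re (\<phi> w) \<le> M"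
  shows "best_bound \<phi> b"
proof (rule best_boundI)
  show b10: "10 / 9 < b" using M by (simp add: b less_divide_eq)
  show "subordinate (extremal b) \<phi>"
  proof (rule extremal_subordinateI[OF hol\<phi> _ holf f0 f])
    fix \<zeta> :: complex assume "norm \<zeta> = 1"
    moreover have "8 / 9 \<le> \<bar>b * (1 - Re (1 / \<phi> \<zeta>))\<bar>" if "Re (1 / \<phi> \<zeta>) \<le> 1 / M"
    proof -
      have "8 / 9 = b * (1 - 1 / M)" using M by (simp add: b field_simps)
      also have "\<dots> \<le> b * (1 - Re (1 / \<phi> \<zeta>))"
        using that b10 by (intro mult_left_mono) auto
      finally show ?thesis by linarith
    qed
    ultimately show "10 / 9 * norm (\<phi> \<zeta>) \<le> b * norm (\<phi> \<zeta> - 1)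
      \<or> 8 / 9 \<le> \<bar>b * (1 - Re (1 / \<phi> \<zeta>))\<bar> \<or>
       (\<forall>z. norm z < 1 \<longrightarrow> nephroid_primitive z \<noteq> of_real b * (1 - 1 / \<phi> \<zeta>))"
      using circle by blast
  qed (use b10 in simp_all)
  fix \<beta> assume \<beta>: "10 / 9 < \<beta>" "\<beta> < b"
  have "\<beta> * (9 * (M - 1)) < 8 * M" using \<beta>(2) M by (simp add: b pos_less_divide_eq)
  then obtain r where "\<bar>r\<bar> < 1" "M < 1 / (1 - (r - r ^ 3 / 9) / \<beta>)"
    using extremal_real_near_1[of \<beta> M] \<beta> M by auto
  then show "\<exists>r. \<bar>r\<bar> < 1 \<and> (\<forall>w. norm w < 1 \<longrightarrow> \<phi> w \<noteq> of_real (1 / (1 - (r - r ^ 3 / 9) / \<beta>)))"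
    using le by (metis Im_complex_of_real Re_complex_of_real not_less)
qed

text \<open>Inversion turns the half-plane into the complement of the open disk with diameter from 0
  to M. At z = 0 the totalised quotient is 0, which satisfies the bound.\<close>

lemma Re_one_divide_le:
  fixes z :: complex and M :: real
  assumes "0 < M" "M * Re z \<le> (norm z)\<^sup>2"
  shows "Re (1 / z) \<le> 1 / M"
proof (cases "z = 0")
  case False
  have "Re (1 / z) = Re z / (norm z)\<^sup>2"
    by (simp add: Re_divide cmod_power2)
  also have "\<dots> \<le> 1 / M"
    using False assms by (simp add: field_simps)
  finally show ?thesis .
qed (use assms in simp)

text \<open>A real value v forces H z = b (1 - 1/v), which must be below 8/9 = b (1 - 1/M). This
  keeps the arguments of \<open>Arcsin\<close> off its branch cuts.\<close>

lemma Re_extremal_less: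
  assumes M: "1 < M" "M < 5" and b: "b = 8 * M / (9 * (M - 1))" and z: "norm z < 1"
    and real: "Im (extremal b z) = 0"
  shows "Re (extremal b z) < M"
proof -
  have b10: "10 / 9 < b" using M by (simp add: b less_divide_eq)
  define v where "v = Re (extremal b z)"
  have v: "extremal b z = of_real v" using real by (simp add: v_def complex_eq_iff)
  have v2: "1 / 2 < v" using Re_extremal_gt_half[of b z] b10 z by (simp add: v_def)
  have "nephroid_primitive z / of_real b = of_real (1 - 1 / v)"
    using v v2 extremal_denom_nonzero[of b z] b10 z by (auto simp: extremal_def field_simps)
  then have "nephroid_primitive z = of_real (b * (1 - 1 / v))"
    using b10 by (simp add: field_simps)
  then have "b * (1 - 1 / v) < 8 / 9"
    using abs_Re_nephroid_primitive_less[OF z] by (simp only: Re_complex_of_real abs_less_iff)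
  also have "8 / 9 = b * (1 - 1 / M)" using M by (simp add: b field_simps)
  finally have "1 / M < 1 / v" using b10 by simp
  then show ?thesis using M v2 by (simp add: v_def[symmetric] field_simps)
qed

lemma nonpos_Reals_notI: "0 < Re z \<Longrightarrow> z \<notin> \<real>\<^sub>\<le>\<^sub>0"
  by (auto simp: complex_nonpos_Reals_iff)

subsection \<open>The majorants\<close>

lemma unit_circle_Im: "norm \<zeta> = 1 \<Longrightarrow> (Im \<zeta>)\<^sup>2 = 1 - (Re \<zeta>)\<^sup>2"
  using cmod_power2[of \<zeta>] by simp

lemma unit_circle_Re: "norm \<zeta> = 1 \<Longrightarrow> -1 \<le> Re \<zeta> \<and> Re \<zeta> \<le> 1"
  using abs_Re_le_cmod[of \<zeta>] by auto

lemma sqrt2_bounds: "141 / 100 < sqrt 2" "sqrt 2 < 142 / 100"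
  by (rule real_less_rsqrt real_less_lsqrt; simp add: power2_eq_square)+

section \<open>Majorants inverted by algebraic formulas and square roots\<close>

text \<open>The functions sqrt (1 + z^2) + z and sqrt (1 + z^2) - z are reciprocal. Hence the
  inverse of the majorant is (v - 1/v)/2, and on the circle 1/\<phi> is simply q - \<zeta>.\<close>

lemma best_bound_crescent:
  "best_bound (\<lambda>z. csqrt (1 + z\<^sup>2) + z) (4 / 9 * (2 + sqrt 2))"
proof (rule best_boundI_right[where M = "1 + sqrt 2"
      and f = "\<lambda>z. (extremal (4 / 9 * (2 + sqrt 2)) z - 1 / extremal (4 / 9 * (2 + sqrt 2)) z) / 2"])
  define b where "b = 4 / 9 * (2 + sqrt 2)"
  have b10: "10 / 9 < b" using sqrt2_bounds by (simp add: b_def)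
  show "1 < 1 + sqrt 2" by simp
  show "1 + sqrt 2 < 5" using sqrt2_bounds by simp
  show "4 / 9 * (2 + sqrt 2) = 8 * (1 + sqrt 2) / (9 * (1 + sqrt 2 - 1))"
    by (simp add: field_simps)
  have Re_pos: "0 < Re (1 + w\<^sup>2)" if "norm w < 1" for w :: complex
  proof -
    have "norm (w\<^sup>2) < 1" using that by (simp add: norm_power abs_square_less_1)
    then show ?thesis using abs_Re_le_cmod[of "w\<^sup>2"] by simp
  qed
  show "(\<lambda>z. csqrt (1 + z\<^sup>2) + z) holomorphic_on ball 0 1"
    by (intro holomorphic_intros nonpos_Reals_notI Re_pos) auto
  have Re_v: "1 / 2 < Re (extremal b z)" if "norm z < 1" for z
    using Re_extremal_gt_half[of b z] b10 that by simp
  then have v0: "extremal b z \<noteq> 0" if "norm z < 1" for z using that by force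
  show "(\<lambda>z. (extremal (4 / 9 * (2 + sqrt 2)) z - 1 / extremal (4 / 9 * (2 + sqrt 2)) z) / 2)
      holomorphic_on ball 0 1"
    unfolding b_def[symmetric] using b10 v0
    by (intro holomorphic_intros holomorphic_extremal) auto
  show "(extremal (4 / 9 * (2 + sqrt 2)) 0 - 1 / extremal (4 / 9 * (2 + sqrt 2)) 0) / 2 = 0"
    by simp
  show "csqrt (1 + ((extremal (4 / 9 * (2 + sqrt 2)) z - 1 / extremal (4 / 9 * (2 + sqrt 2)) z) / 2)\<^sup>2)
     + (extremal (4 / 9 * (2 + sqrt 2)) z - 1 / extremal (4 / 9 * (2 + sqrt 2)) z) / 2
     = extremal (4 / 9 * (2 + sqrt 2)) z" if z: "norm z < 1" for z
    unfolding b_def[symmetric]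
  proof -
    define v where "v = extremal b z"
    have v: "0 < Re v" "v \<noteq> 0" using Re_v[OF z] v0[OF z] by (simp_all add: v_def)
    have "csqrt (1 + ((v - 1 / v) / 2)\<^sup>2) = (v + 1 / v) / 2"
    proof (rule csqrt_unique)
      show "((v + 1 / v) / 2)\<^sup>2 = 1 + ((v - 1 / v) / 2)\<^sup>2"
        using v(2) by (simp add: field_simps power2_eq_square)
      have "0 < Re (1 / v)" using v by (simp add: Re_divide sum_power2_gt_zero_iff)
      then show "0 < Re ((v + 1 / v) / 2) \<or> Re ((v + 1 / v) / 2) = 0 \<and> 0 \<le> Im ((v + 1 / v) / 2)"
        using v(1) by simp
    qed
    then show "csqrt (1 + ((extremal b z - 1 / extremal b z) / 2)\<^sup>2)
       + (extremal b z - 1 / extremal b z) / 2 = extremal b z"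
      unfolding v_def[symmetric] by (simp add: field_simps)
  qed
  show "10 / 9 * norm (csqrt (1 + \<zeta>\<^sup>2) + \<zeta>) \<le> 4 / 9 * (2 + sqrt 2) * norm (csqrt (1 + \<zeta>\<^sup>2) + \<zeta> - 1)
     \<or> Re (1 / (csqrt (1 + \<zeta>\<^sup>2) + \<zeta>)) \<le> 1 / (1 + sqrt 2) \<or>
     (\<forall>z. norm z < 1 \<longrightarrow> nephroid_primitive z \<noteq>
        of_real (4 / 9 * (2 + sqrt 2)) * (1 - 1 / (csqrt (1 + \<zeta>\<^sup>2) + \<zeta>)))"
    if \<zeta>: "norm \<zeta> = 1" for \<zeta>
  proof -
    define c s q where "c = Re \<zeta>" and "s = Im \<zeta>" and "q = csqrt (1 + \<zeta>\<^sup>2)"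
    define \<alpha> \<gamma> where "\<alpha> = Re q" and "\<gamma> = Im q"
    have s2: "s\<^sup>2 = 1 - c\<^sup>2" and c1: "-1 \<le> c" "c \<le> 1"
      using unit_circle_Im[OF \<zeta>] unit_circle_Re[OF \<zeta>] by (auto simp: c_def s_def)
    have q2: "q\<^sup>2 = 1 + \<zeta>\<^sup>2" by (simp add: q_def)
    \<comment> \<open>On the unit circle 1 + \<zeta>^2 = 2 c \<zeta>, which accounts for the real
      part, the imaginary part and the modulus of q^2.\<close>
    have "Re (q\<^sup>2) = 2 * c\<^sup>2" "Im (q\<^sup>2) = 2 * c * s"
      unfolding q2 using s2 by (simp_all add: c_def s_def power2_eq_square)
    then have re: "\<alpha>\<^sup>2 - \<gamma>\<^sup>2 = 2 * c\<^sup>2" and im: "\<alpha> * \<gamma> = c * s"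
      by (simp_all add: \<alpha>_def \<gamma>_def power2_eq_square mult.commute)
    have "(\<alpha>\<^sup>2 + \<gamma>\<^sup>2)\<^sup>2 = (\<alpha>\<^sup>2 - \<gamma>\<^sup>2)\<^sup>2 + 4 * (\<alpha> * \<gamma>)\<^sup>2"
      by (simp add: power2_eq_square algebra_simps)
    also have "\<dots> = 4 * c\<^sup>2 * (c\<^sup>2 + s\<^sup>2)"
      unfolding re im by (simp add: power2_eq_square algebra_simps)
    also have "\<dots> = (2 * \<bar>c\<bar>)\<^sup>2" by (simp add: s2 power_mult_distrib)
    finally have sum: "\<alpha>\<^sup>2 + \<gamma>\<^sup>2 = 2 * \<bar>c\<bar>"
      by (rule power2_eq_imp_eq) auto
    have \<alpha>2: "\<alpha>\<^sup>2 = c\<^sup>2 + \<bar>c\<bar>" and \<gamma>2: "\<gamma>\<^sup>2 = \<bar>c\<bar> - c\<^sup>2" using re sum by simp_all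
    have \<alpha>0: "0 \<le> \<alpha>" unfolding \<alpha>_def q_def using Re_csqrt by blast
    have inv: "(q + \<zeta>) * (q - \<zeta>) = 1"
      using q2 by (simp add: algebra_simps power2_eq_square)
    then have inv': "1 / (q + \<zeta>) = q - \<zeta>"
      by (metis divide_eq_eq mult.commute mult_zero_left zero_neq_one)
    show ?thesis
    proof (cases "0 \<le> c")
      case True
      \<comment> \<open>Here 3 - 2 sqrt 2 = (sqrt 2 - 1)^2. After squaring, the half-plane condition
        is exactly this inequality, with equality at c = 1.\<close>
      have "c * (3 - 2 * sqrt 2) \<le> 1 * (3 - 2 * sqrt 2)"
        using c1 sqrt2_bounds by (intro mult_right_mono) auto
      then have "\<alpha>\<^sup>2 \<le> (c + sqrt 2 - 1)\<^sup>2"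
        unfolding \<alpha>2 using True by (simp add: power2_eq_square algebra_simps)
      then have "\<alpha> \<le> c + sqrt 2 - 1"
        by (rule power2_le_imp_le) (use True sqrt2_bounds in auto)
      moreover have "1 / (1 + sqrt 2) = sqrt 2 - 1" 
      proof -
        have "(sqrt 2 - 1) * (1 + sqrt 2) = 1" by (simp add: algebra_simps)
        then show ?thesis using sqrt2_bounds by (simp add: divide_eq_eq)
      qed
      ultimately show ?thesis
        unfolding q_def[symmetric] inv' by (simp add: \<alpha>_def c_def)
    next
      case False
      define g where "g = - c"
      have g: "0 < g" "g \<le> 1" using False c1 by (auto simp: g_def)
      have \<alpha>g: "\<alpha>\<^sup>2 = g\<^sup>2 + g" and \<gamma>g: "\<gamma>\<^sup>2 = g - g\<^sup>2" and sg: "s\<^sup>2 = 1 - g\<^sup>2" and img: "\<alpha> * \<gamma> = - g * s"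
        using \<alpha>2 \<gamma>2 s2 im g by (auto simp: g_def)
      have "(norm (1 - q + \<zeta>))\<^sup>2 = (1 - g - \<alpha>)\<^sup>2 + (s - \<gamma>)\<^sup>2"
        unfolding cmod_power2 by (simp add: \<alpha>_def \<gamma>_def g_def c_def s_def algebra_simps)
      \<comment> \<open>Up to g = 39/50 the imaginary part suffices: s \<gamma> \<le> 0 makes its
        square at least 1 + g - 2 g^2. Beyond that \<alpha> \<ge> 1, and the real part has modulus
        at least g.\<close>
      also have "\<dots> \<ge> 14 / 25"
      proof (cases "g \<le> 39 / 50")
        case True
        have "\<alpha> \<noteq> 0" using \<alpha>g g by (smt (verit) zero_eq_power2 zero_le_power2)
        then have "0 < \<alpha>" using \<alpha>0 by simp
        have "\<alpha> * (s * \<gamma>) = - (g * s\<^sup>2)"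
          using arg_cong[OF img, of "\<lambda>x. x * s"] by (simp add: power2_eq_square mult_ac)
        then have "\<alpha> * (s * \<gamma>) \<le> 0" using g by simp
        then have "s * \<gamma> \<le> 0" using \<open>0 < \<alpha>\<close> by (simp add: mult_le_0_iff)
        then have "(s - \<gamma>)\<^sup>2 \<ge> s\<^sup>2 + \<gamma>\<^sup>2" 
          using power2_diff[of s \<gamma>] by linarith
        moreover have "g * g \<le> 39 / 50 * g" using True g by (intro mult_right_mono) auto
        ultimately have "(s - \<gamma>)\<^sup>2 \<ge> 14 / 25"
          using True g unfolding \<gamma>g sg unfolding power2_eq_square by linarith
        then show ?thesis using zero_le_power2[of "1 - g - \<alpha>"] by linarith
      next
        case False
        have "1 \<le> \<alpha>\<^sup>2" unfolding \<alpha>g using False mult_mono[of "39 / 50" g "39 / 50" g] by (simp add: power2_eq_square)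
        then have "1\<^sup>2 \<le> \<alpha>\<^sup>2" by simp
        then have "1 \<le> \<alpha>" using \<alpha>0 by (rule power2_le_imp_le)
        then have "(39 / 50) * (39 / 50) \<le> (\<alpha> - (1 - g)) * (\<alpha> - (1 - g))" using False by (intro mult_mono) auto
        also have "\<dots> = (1 - g - \<alpha>)\<^sup>2" by (simp add: power2_eq_square algebra_simps)
        finally show ?thesis using zero_le_power2[of "s - \<gamma>"] by linarith
      qed
      finally have "(74 / 100 :: real)\<^sup>2 \<le> (norm (1 - q + \<zeta>))\<^sup>2" by (simp add: power2_eq_square)
      then have N: "74 / 100 \<le> norm (1 - q + \<zeta>)" by (rule power2_le_imp_le) simp
      have "10 / 9 \<le> b * (74 / 100)" using sqrt2_bounds by (simp add: b_def)
      also have "\<dots> \<le> b * norm (1 - q + \<zeta>)"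
        using N b10 by (intro mult_left_mono) auto
      finally have "10 / 9 * norm (q + \<zeta>) \<le> b * norm (1 - q + \<zeta>) * norm (q + \<zeta>)"
        by (intro mult_right_mono) auto
      moreover have "q + \<zeta> - 1 = (q + \<zeta>) * (1 - q + \<zeta>)" using inv by (simp add: algebra_simps)
      ultimately show ?thesis
        unfolding q_def[symmetric] b_def[symmetric] by (simp add: norm_mult mult_ac)
    qed
  qed
  show "Re (csqrt (1 + w\<^sup>2) + w) \<le> 1 + sqrt 2" if "norm w < 1" for w
  proof -
    have "norm (1 + w\<^sup>2) \<le> 1 + 1"
      using that by (intro norm_triangle_le add_mono) (auto simp: norm_power abs_square_le_1)
    then have "norm (csqrt (1 + w\<^sup>2)) \<le> sqrt 2" by simp
    then show ?thesis
      using that complex_Re_le_cmod[of "csqrt (1 + w\<^sup>2)"] complex_Re_le_cmod[of w]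
      unfolding plus_complex.simps by linarith
  qed
qed

text \<open>Completing the square, \<phi>(z) = (2 (1 + z)^2 + 1)/3, which gives the inverse.\<close>

lemma best_bound_cardioid:
  "best_bound (\<lambda>z. 1 + 4 / 3 * z + 2 / 3 * z\<^sup>2) (4 / 3)"
proof (rule best_boundI_right[where M = 3 and f = "\<lambda>z. csqrt ((3 * extremal (4 / 3) z - 1) / 2) - 1"])
  have Re_v: "1 / 2 < Re (extremal (4 / 3) z)" if "norm z < 1" for z
    using Re_extremal_gt_half[of "4 / 3" z] that by simp
  show "(\<lambda>z. 1 + 4 / 3 * z + 2 / 3 * z\<^sup>2) holomorphic_on ball 0 1"
    by (intro holomorphic_intros)
  show "(\<lambda>z. csqrt ((3 * extremal (4 / 3) z - 1) / 2) - 1) holomorphic_on ball 0 1"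
    using Re_v by (intro holomorphic_intros holomorphic_extremal nonpos_Reals_notI) force+
  show "1 + 4 / 3 * (csqrt ((3 * extremal (4 / 3) z - 1) / 2) - 1)
     + 2 / 3 * (csqrt ((3 * extremal (4 / 3) z - 1) / 2) - 1)\<^sup>2 = extremal (4 / 3) z" for z
  proof -
    define q where "q = csqrt ((3 * extremal (4 / 3) z - 1) / 2)"
    have "q\<^sup>2 = (3 * extremal (4 / 3) z - 1) / 2" by (simp add: q_def)
    then have v: "extremal (4 / 3) z = (2 * q\<^sup>2 + 1) / 3" by (simp add: field_simps)
    show ?thesis unfolding q_def[symmetric] unfolding v by (simp add: power2_eq_square field_simps)
  qed
  show "10 / 9 * norm (1 + 4 / 3 * \<zeta> + 2 / 3 * \<zeta>\<^sup>2) \<le> 4 / 3 * norm (1 + 4 / 3 * \<zeta> + 2 / 3 * \<zeta>\<^sup>2 - 1)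
     \<or> Re (1 / (1 + 4 / 3 * \<zeta> + 2 / 3 * \<zeta>\<^sup>2)) \<le> 1 / 3 \<or>
     (\<forall>z. norm z < 1 \<longrightarrow> nephroid_primitive z \<noteq>
        of_real (4 / 3) * (1 - 1 / (1 + 4 / 3 * \<zeta> + 2 / 3 * \<zeta>\<^sup>2)))"
    if \<zeta>: "norm \<zeta> = 1" for \<zeta>
  proof -
    define c s \<phi> where "c = Re \<zeta>" and "s = Im \<zeta>" and "\<phi> = 1 + 4 / 3 * \<zeta> + 2 / 3 * \<zeta>\<^sup>2"
    have s2: "s\<^sup>2 = 1 - c\<^sup>2" and c1: "-1 \<le> c" "c \<le> 1"
      using unit_circle_Im[OF \<zeta>] unit_circle_Re[OF \<zeta>] by (auto simp: c_def s_def)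
    have "Re \<phi> = 1 + 4 / 3 * c + 2 / 3 * (c\<^sup>2 - s\<^sup>2)"
      by (simp add: \<phi>_def c_def s_def power2_eq_square)
    then have Re\<phi>: "Re \<phi> = (1 + 4 * c + 4 * c\<^sup>2) / 3"
      unfolding s2 by (simp add: field_simps)
    have Im\<phi>: "Im \<phi> = 4 * (s * (1 + c)) / 3"
      by (simp add: \<phi>_def c_def s_def power2_eq_square field_simps)
    have "(norm \<phi>)\<^sup>2 = ((1 + 4 * c + 4 * c\<^sup>2)\<^sup>2 + 16 * ((1 - c\<^sup>2) * (1 + c)\<^sup>2)) / 9"
      unfolding cmod_power2 Re\<phi> Im\<phi> power_divide power_mult_distrib s2 by (simp add: add_divide_distrib)
    also have "(1 + 4 * c + 4 * c\<^sup>2)\<^sup>2 + 16 * ((1 - c\<^sup>2) * (1 + c)\<^sup>2) = 17 + 40 * c + 24 * c\<^sup>2"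
      by (simp add: power2_eq_square algebra_simps)
    finally have n\<phi>: "(norm \<phi>)\<^sup>2 = (17 + 40 * c + 24 * c\<^sup>2) / 9" .
    \<comment> \<open>The expression |\<phi>|^2 - 3 Re \<phi> vanishes at the contact point c = 1
      and changes sign at c = -2/3. To the left of -2/3, |\<phi>| \<le> 1/3 and |\<phi> - 1| \<ge>
      2/3, so the disk is avoided.\<close>
    show ?thesis
    proof (cases "- 2 / 3 \<le> c")
      case True
      have "(norm \<phi>)\<^sup>2 - 3 * Re \<phi> = 4 / 9 * ((1 - c) * (2 + 3 * c))"
        unfolding n\<phi> Re\<phi> by (simp add: power2_eq_square field_simps)
      moreover have "0 \<le> (1 - c) * (2 + 3 * c)" using True c1 by (intro mult_nonneg_nonneg) auto
      ultimately show ?thesis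
        unfolding \<phi>_def[symmetric] using Re_one_divide_le[of 3 \<phi>] by auto
    next
      case False
      have "(norm \<phi>)\<^sup>2 = (1 - 8 * ((1 + c) * (1 - 3 * (1 + c)))) / 9"
        unfolding n\<phi>
        by (simp add: power2_eq_square algebra_simps)
      moreover have "0 \<le> (1 + c) * (1 - 3 * (1 + c))"
        using False c1 by (intro mult_nonneg_nonneg) auto
      ultimately have "(norm \<phi>)\<^sup>2 \<le> (1 / 3)\<^sup>2" by (simp add: power2_eq_square)
      then have "norm \<phi> \<le> 1 / 3" by (rule power2_le_imp_le) simp
      moreover have "\<phi> - 1 = 2 / 3 * (\<zeta> * (2 + \<zeta>))" by (simp add: \<phi>_def power2_eq_square algebra_simps)
      then have "norm (\<phi> - 1) = norm (2 / 3 :: complex) * (norm \<zeta> * norm (2 + \<zeta>))"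
        by (simp only: norm_mult)
      then have "norm (\<phi> - 1) = 2 / 3 * norm (2 + \<zeta>)" using \<zeta> by simp
      moreover have "1 \<le> norm (2 + \<zeta>)" using norm_triangle_ineq2[of 2 "- \<zeta>"] \<zeta> by simp
      ultimately show ?thesis unfolding \<phi>_def[symmetric] by simp
    qed
  qed
  show "Re (1 + 4 / 3 * w + 2 / 3 * w\<^sup>2) \<le> 3" if "norm w < 1" for w
  proof -
    have "norm (w\<^sup>2) \<le> 1" using that by (simp add: norm_power abs_square_le_1)
    then show ?thesis
      using that complex_Re_le_cmod[of w] complex_Re_le_cmod[of "w\<^sup>2"] by simp
  qed
qed simp_all

text \<open>The majorant is the square (1 + z / sqrt 2)^2. This yields the inverse and explains why
  |\<phi>| is |3/2 + sqrt 2 c| on the circle.\<close>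

lemma best_bound_limacon:
  "best_bound (\<lambda>z. 1 + of_real (sqrt 2) * z + 1 / 2 * z\<^sup>2) (8 / 63 * (5 + 4 * sqrt 2))"
proof (rule best_boundI_right[where M = "3 / 2 + sqrt 2"
      and f = "\<lambda>z. of_real (sqrt 2) * (csqrt (extremal (8 / 63 * (5 + 4 * sqrt 2)) z) - 1)"])
  define b where "b = 8 / 63 * (5 + 4 * sqrt 2)"
  have b10: "4 / 3 < b" using sqrt2_bounds by (simp add: b_def)
  show "1 < 3 / 2 + sqrt 2" "3 / 2 + sqrt 2 < 5" using sqrt2_bounds by simp_all
  show "8 / 63 * (5 + 4 * sqrt 2) = 8 * (3 / 2 + sqrt 2) / (9 * (3 / 2 + sqrt 2 - 1))"
  proof -
    have "8 / 63 * (5 + 4 * t) * (9 * (3 / 2 + t - 1)) = 8 / 7 * (5 / 2 + 7 * t + 4 * (t * t))"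
      for t :: real by (simp add: algebra_simps)
    from this[of "sqrt 2"] have "8 / 63 * (5 + 4 * sqrt 2) * (9 * (3 / 2 + sqrt 2 - 1)) = 8 * (3 / 2 + sqrt 2)"
      by simp
    then show ?thesis using sqrt2_bounds by (simp only: eq_divide_eq) auto
  qed
  have Re_v: "1 / 2 < Re (extremal b z)" if "norm z < 1" for z
    using Re_extremal_gt_half[of b z] b10 that by simp
  have t2: "complex_of_real (sqrt 2) * complex_of_real (sqrt 2) = 2"
    by (simp flip: of_real_mult)
  show "(\<lambda>z. 1 + of_real (sqrt 2) * z + 1 / 2 * z\<^sup>2) holomorphic_on ball 0 1"
    by (intro holomorphic_intros)
  show "(\<lambda>z. of_real (sqrt 2) * (csqrt (extremal (8 / 63 * (5 + 4 * sqrt 2)) z) - 1))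
      holomorphic_on ball 0 1"
    unfolding b_def[symmetric] using Re_v b10
    by (intro holomorphic_intros holomorphic_extremal nonpos_Reals_notI) force+
  show "1 + of_real (sqrt 2) * (of_real (sqrt 2) * (csqrt (extremal (8 / 63 * (5 + 4 * sqrt 2)) z) - 1))
     + 1 / 2 * (of_real (sqrt 2) * (csqrt (extremal (8 / 63 * (5 + 4 * sqrt 2)) z) - 1))\<^sup>2
     = extremal (8 / 63 * (5 + 4 * sqrt 2)) z" for z
  proof -
    define v where "v = extremal (8 / 63 * (5 + 4 * sqrt 2)) z"
    define q where "q = csqrt v"
    have "1 + of_real (sqrt 2) * (of_real (sqrt 2) * (q - 1)) + 1 / 2 * (of_real (sqrt 2) * (q - 1))\<^sup>2
      = 1 + (complex_of_real (sqrt 2) * complex_of_real (sqrt 2)) * ((q - 1) + 1 / 2 * (q - 1)\<^sup>2)"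
      by (simp add: power2_eq_square algebra_simps)
    also have "\<dots> = q\<^sup>2" unfolding t2 by (simp add: power2_eq_square algebra_simps)
    also have "\<dots> = v" by (simp add: q_def)
    finally show ?thesis unfolding q_def v_def .
  qed
  show "10 / 9 * norm (1 + of_real (sqrt 2) * \<zeta> + 1 / 2 * \<zeta>\<^sup>2)
       \<le> 8 / 63 * (5 + 4 * sqrt 2) * norm (1 + of_real (sqrt 2) * \<zeta> + 1 / 2 * \<zeta>\<^sup>2 - 1)
     \<or> Re (1 / (1 + of_real (sqrt 2) * \<zeta> + 1 / 2 * \<zeta>\<^sup>2)) \<le> 1 / (3 / 2 + sqrt 2) \<or>
     (\<forall>z. norm z < 1 \<longrightarrow> nephroid_primitive z \<noteq>
        of_real (8 / 63 * (5 + 4 * sqrt 2)) * (1 - 1 / (1 + of_real (sqrt 2) * \<zeta> + 1 / 2 * \<zeta>\<^sup>2)))"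
    if \<zeta>: "norm \<zeta> = 1" for \<zeta>
  proof -
    define c s t \<phi> where "c = Re \<zeta>" and "s = Im \<zeta>" and "t = sqrt 2"
      and "\<phi> = 1 + of_real (sqrt 2) * \<zeta> + 1 / 2 * \<zeta>\<^sup>2"
    have tt: "t * t = 2" and tb: "141 / 100 < t" "t < 142 / 100"
      using sqrt2_bounds by (simp_all add: t_def)
    have s2: "s\<^sup>2 = 1 - c\<^sup>2" and c1: "-1 \<le> c" "c \<le> 1"
      using unit_circle_Im[OF \<zeta>] unit_circle_Re[OF \<zeta>] by (auto simp: c_def s_def)
    have "Re \<phi> = 1 + t * c + (c\<^sup>2 - s\<^sup>2) / 2"
      by (simp add: \<phi>_def c_def s_def t_def power2_eq_square)
    then have Re\<phi>: "Re \<phi> = 1 / 2 + t * c + c\<^sup>2"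
      unfolding s2 by (simp add: field_simps)
    have Im\<phi>: "Im \<phi> = s * (t + c)"
      by (simp add: \<phi>_def c_def s_def t_def power2_eq_square algebra_simps)
    have "(norm \<phi>)\<^sup>2 = (1 / 2 + t * c + c\<^sup>2)\<^sup>2 + (1 - c\<^sup>2) * (t + c)\<^sup>2"
      unfolding cmod_power2 Re\<phi> Im\<phi> power_mult_distrib s2 by simp
    also have "\<dots> = 1 / 4 + t * c + c\<^sup>2 + t * t + 2 * (t * c) + c\<^sup>2"
      by (simp add: power2_eq_square algebra_simps)
    also have "\<dots> = 9 / 4 + 3 * (t * c) + (t * t) * c\<^sup>2"
      unfolding tt by simp
    finally have n\<phi>: "(norm \<phi>)\<^sup>2 = (3 / 2 + t * c)\<^sup>2" by (simp add: power2_eq_square algebra_simps)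
    show ?thesis
    proof (cases "0 \<le> (3 / 2 - t / 2) + (t - 1 / 2) * c")
      case True
      have "(norm \<phi>)\<^sup>2 - (3 / 2 + t) * Re \<phi>
         = (3 / 2 - t / 2) + (3 / 2 * t - t * t) * c + (t * t - 3 / 2 - t) * c\<^sup>2"
        unfolding n\<phi> Re\<phi> by (simp add: power2_eq_square algebra_simps)
      also have "\<dots> = (1 - c) * ((3 / 2 - t / 2) + (t - 1 / 2) * c)"
        unfolding tt by (simp add: power2_eq_square field_simps)
      finally have "(3 / 2 + t) * Re \<phi> \<le> (norm \<phi>)\<^sup>2"
        using True c1 by (smt (verit) mult_nonneg_nonneg)
      then show ?thesis
        unfolding \<phi>_def[symmetric] unfolding t_def[symmetric] using Re_one_divide_le[of "3 / 2 + t" \<phi>] tb by auto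
    next
      case False
      \<comment> \<open>The linear factor vanishes near c = -0.867; -17/20 is that zero rounded
        up.\<close>
      have cl: "c < - 17 / 20"
      proof (rule ccontr)
        assume "\<not> c < - 17 / 20"
        then have "(t - 1 / 2) * (- (17 / 20)) \<le> (t - 1 / 2) * c" using tb by (intro mult_left_mono) auto
        moreover have "(t - 1 / 2) * (- (17 / 20)) = 17 / 40 - 17 / 20 * t" by (simp add: field_simps)
        ultimately show False using False tb by linarith
      qed
      have "t * c \<le> 141 / 100 * c" by (rule mult_right_mono_neg) (use cl tb in linarith)+
      moreover have "142 / 100 * c \<le> t * c" by (rule mult_right_mono_neg) (use cl tb in linarith)+
      moreover have "141 / 100 * c \<le> - (11 / 10)" "- (142 / 100) \<le> 142 / 100 * c"
        using cl c1 by linarith+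
      ultimately have "\<bar>3 / 2 + t * c\<bar> \<le> 2 / 5" by linarith
      then have "(norm \<phi>)\<^sup>2 \<le> (2 / 5)\<^sup>2" 
        unfolding n\<phi> using power_mono[of "\<bar>3 / 2 + t * c\<bar>" "2 / 5" 2] by (simp only: power2_abs abs_ge_zero)
      then have "norm \<phi> \<le> 2 / 5" by (rule power2_le_imp_le) simp
      moreover have "\<phi> - 1 = \<zeta> * (of_real t + \<zeta> / 2)" by (simp add: \<phi>_def t_def power2_eq_square algebra_simps)
      then have "norm (\<phi> - 1) = norm (of_real t + \<zeta> / 2)" using \<zeta> by (simp add: norm_mult)
      moreover have "91 / 100 \<le> norm (of_real t + \<zeta> / 2)"
        using norm_triangle_ineq2[of "of_real t" "- \<zeta> / 2"] \<zeta> tb by (simp add: norm_divide)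
      ultimately have "91 / 100 \<le> norm (\<phi> - 1)" and n\<phi>': "norm \<phi> \<le> 2 / 5" by simp_all
      then have "4 / 3 * (91 / 100) \<le> b * norm (\<phi> - 1)" using b10 by (intro mult_mono) auto
      then have "10 / 9 * norm \<phi> \<le> b * norm (\<phi> - 1)" using n\<phi>' by linarith
      then show ?thesis unfolding \<phi>_def[symmetric] b_def[symmetric] by simp
    qed
  qed
  show "Re (1 + of_real (sqrt 2) * w + 1 / 2 * w\<^sup>2) \<le> 3 / 2 + sqrt 2" if "norm w < 1" for w
  proof -
    have "norm (w\<^sup>2) \<le> 1" using that by (simp add: norm_power abs_square_le_1)
    moreover have "sqrt 2 * Re w \<le> sqrt 2 * 1"
      using that complex_Re_le_cmod[of w] by (intro mult_left_mono) auto
    moreover have "Re (1 + of_real (sqrt 2) * w + 1 / 2 * w\<^sup>2) = 1 + sqrt 2 * Re w + Re (w\<^sup>2) / 2"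
      by simp
    ultimately show ?thesis
      using complex_Re_le_cmod[of "w\<^sup>2"] by linarith
  qed
qed simp_all

section \<open>Majorants inverted by the arcsine\<close>

text \<open>By the triple-angle formula phi_Ne (2 sin A) = 1 + 2/3 sin (3 A), so one third of an
  arcsine inverts the cubic.\<close>

lemma best_bound_nephroid: "best_bound phi_Ne (20 / 9)"
proof (rule best_boundI_right[where M = "5 / 3"
      and f = "\<lambda>z. 2 * sin (Arcsin (3 / 2 * (extremal (20 / 9) z - 1)) / 3)"])
  show "phi_Ne holomorphic_on ball 0 1"
    unfolding phi_Ne_def [abs_def] by (intro holomorphic_intros) auto
  have real: "\<bar>Re (3 / 2 * (extremal (20 / 9) z - 1))\<bar> < 1"
    if "norm z < 1" "Im (3 / 2 * (extremal (20 / 9) z - 1)) = 0" for z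
    using Re_extremal_gt_half[of "20 / 9" z] Re_extremal_less[of "5 / 3" "20 / 9" z] that
    by (auto simp: abs_less_iff)
  have "(\<lambda>z. Arcsin (3 / 2 * (extremal (20 / 9) z - 1))) holomorphic_on ball 0 1"
  proof (rule holomorphic_on_compose_gen[unfolded o_def, where g = Arcsin])
    show "(\<lambda>z. 3 / 2 * (extremal (20 / 9) z - 1)) holomorphic_on ball 0 1"
      by (intro holomorphic_intros holomorphic_extremal) auto
    show "Arcsin holomorphic_on (\<lambda>z. 3 / 2 * (extremal (20 / 9) z - 1)) ` ball 0 1"
      using real by (intro holomorphic_on_Arcsin) auto
  qed auto
  then show "(\<lambda>z. 2 * sin (Arcsin (3 / 2 * (extremal (20 / 9) z - 1)) / 3)) holomorphic_on ball 0 1"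
    by (intro holomorphic_intros) auto
  show "phi_Ne (2 * sin (Arcsin (3 / 2 * (extremal (20 / 9) z - 1)) / 3)) = extremal (20 / 9) z" for z
  proof -
    define A where "A = Arcsin (3 / 2 * (extremal (20 / 9) z - 1)) / 3"
    have "phi_Ne (2 * sin A) = 1 + 2 / 3 * (3 * sin A - 4 * sin A ^ 3)"
      by (simp add: phi_Ne_def power_mult_distrib field_simps)
    also have "3 * sin A - 4 * sin A ^ 3 = sin (3 * A)"
    proof -
      have "sin (3 * A) = sin (2 * A + A)" by (simp add: algebra_simps)
      also have "\<dots> = 2 * sin A * (cos A)\<^sup>2 + (1 - 2 * (sin A)\<^sup>2) * sin A"
        unfolding sin_add sin_double cos_double_sin by (simp add: power2_eq_square)
      also have "\<dots> = 3 * sin A - 4 * sin A ^ 3"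
        unfolding cos_squared_eq by (simp add: power2_eq_square power3_eq_cube algebra_simps)
      finally show ?thesis by simp
    qed
    also have "1 + 2 / 3 * sin (3 * A) = extremal (20 / 9) z" by (simp add: A_def field_simps)
    finally show ?thesis by (simp add: A_def)
  qed
  show "10 / 9 * norm (phi_Ne \<zeta>) \<le> 20 / 9 * norm (phi_Ne \<zeta> - 1)
     \<or> Re (1 / phi_Ne \<zeta>) \<le> 1 / (5 / 3) \<or>
     (\<forall>z. norm z < 1 \<longrightarrow> nephroid_primitive z \<noteq> of_real (20 / 9) * (1 - 1 / phi_Ne \<zeta>))"
    if \<zeta>: "norm \<zeta> = 1" for \<zeta>
  proof -
    define c s where "c = Re \<zeta>" and "s = Im \<zeta>"
    have s2: "s\<^sup>2 = 1 - c\<^sup>2" and c1: "-1 \<le> c" "c \<le> 1"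
      using unit_circle_Im[OF \<zeta>] unit_circle_Re[OF \<zeta>] by (auto simp: c_def s_def)
    have "Re (phi_Ne \<zeta>) = 1 + c - (c ^ 3 - 3 * c * s\<^sup>2) / 3"
      by (simp add: phi_Ne_def c_def s_def power2_eq_square power3_eq_cube algebra_simps)
    then have Re\<phi>: "Re (phi_Ne \<zeta>) = 1 + 2 * c - 4 / 3 * c ^ 3"
      unfolding s2 by (simp add: power2_eq_square power3_eq_cube field_simps)
    have "Im (phi_Ne \<zeta>) = s - (3 * c\<^sup>2 * s - s * s\<^sup>2) / 3"
      by (simp add: phi_Ne_def c_def s_def power2_eq_square power3_eq_cube algebra_simps)
    then have Im\<phi>: "Im (phi_Ne \<zeta>) = s * (4 / 3 * (1 - c\<^sup>2))"
      unfolding s2 by (simp add: power2_eq_square field_simps)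
    have n\<phi>: "(norm (phi_Ne \<zeta>))\<^sup>2 = 25 / 9 + 4 * c - 4 / 3 * c\<^sup>2 - 8 / 3 * c ^ 3"
      unfolding cmod_power2 Re\<phi> Im\<phi> power_mult_distrib s2
      by (simp add: power2_eq_square power3_eq_cube field_simps)
    have nh: "(norm (phi_Ne \<zeta> - 1))\<^sup>2 = 16 / 9 - 4 / 3 * c\<^sup>2"
    proof -
      have "(norm (phi_Ne \<zeta> - 1))\<^sup>2 = (2 * c - 4 / 3 * c ^ 3)\<^sup>2 + (1 - c\<^sup>2) * (4 / 3 * (1 - c\<^sup>2))\<^sup>2"
        unfolding cmod_power2 minus_complex.simps Re\<phi> Im\<phi> s2[symmetric] by (simp add: power2_eq_square)
      then show ?thesis by (simp add: power2_eq_square power3_eq_cube field_simps)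
    qed
    \<comment> \<open>The quadratic factor 2 (c + 2)^2 - 3 changes sign near -0.775, just below
      -7/10. Since 20/9 is twice 10/9, avoiding the disk means |\<phi>| \<le> 2 |\<phi> -
      1|.\<close>
    show ?thesis
    proof (cases "- 7 / 10 \<le> c")
      case True
      have "(norm (phi_Ne \<zeta>))\<^sup>2 - 5 / 3 * Re (phi_Ne \<zeta>) = 2 / 9 * ((1 - c) * (2 * (c + 2)\<^sup>2 - 3))"
        unfolding n\<phi> Re\<phi> by (simp add: power2_eq_square power3_eq_cube field_simps)
      moreover have "(13 / 10) * (13 / 10) \<le> (c + 2) * (c + 2)" using True by (intro mult_mono) auto
      then have "0 \<le> (1 - c) * (2 * (c + 2)\<^sup>2 - 3)"
        using c1 by (intro mult_nonneg_nonneg) (auto simp: power2_eq_square)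
      ultimately show ?thesis using Re_one_divide_le[of "5 / 3" "phi_Ne \<zeta>"] by auto
    next
      case False
      have cc: "c * c \<le> 1" using c1 mult_mono[of "-c" 1 "-c" 1] False by auto
      have "c * (4 - 8 / 3 * (c * c)) \<le> c * (4 - 8 / 3)"
        using cc False by (intro mult_left_mono_neg) auto
      then have "4 * c - 8 / 3 * (c * c * c) \<le> 4 / 3 * c" by (simp add: algebra_simps)
      moreover have "25 / 9 + 4 * c - 4 / 3 * x - 8 / 3 * y \<le> 4 * (16 / 9 - 4 / 3 * x)"
        if "4 * c - 8 / 3 * y \<le> 4 / 3 * c" "x \<le> 1" for x y
        using that False by (simp add: field_simps)
      ultimately have "(norm (phi_Ne \<zeta>))\<^sup>2 \<le> 4 * (norm (phi_Ne \<zeta> - 1))\<^sup>2"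
        unfolding n\<phi> nh unfolding power2_eq_square power3_eq_cube
        using cc by blast
      also have "\<dots> = (2 * norm (phi_Ne \<zeta> - 1))\<^sup>2" by (simp add: power_mult_distrib)
      finally have "norm (phi_Ne \<zeta>) \<le> 2 * norm (phi_Ne \<zeta> - 1)" by (rule power2_le_imp_le) simp
      then show ?thesis by simp
    qed
  qed
  \<comment> \<open>Off the real axis the claim is false: near exp (i pi/4) the real part exceeds
    5/3. In the disk, however, real values are taken only at real points.\<close>
  show "Re (phi_Ne w) \<le> 5 / 3" if w: "norm w < 1" and im: "Im (phi_Ne w) = 0" for w
  proof -
    define x y where "x = Re w" and "y = Im w"
    have "x\<^sup>2 + y\<^sup>2 < 1" using w cmod_power2[of w] abs_square_less_1[of "norm w"] by (simp add: x_def y_def)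
    then have x2: "x\<^sup>2 < 1" using zero_le_power2[of y] by linarith
    have "Im (phi_Ne w) = y * (1 - x\<^sup>2 + y\<^sup>2 / 3)"
      by (simp add: phi_Ne_def x_def y_def power2_eq_square power3_eq_cube field_simps)
    moreover have "0 < 1 - x\<^sup>2 + y\<^sup>2 / 3" using x2 by (simp add: add_pos_nonneg)
    ultimately have "y = 0" using im by simp
    then have "w = of_real x" by (simp add: x_def y_def complex_eq_iff)
    then have "Re (phi_Ne w) = 1 + x - x ^ 3 / 3"
      by (simp add: phi_Ne_def power3_eq_cube)
    moreover have "0 \<le> (1 - x)\<^sup>2 * (x + 2)"
      using x2 by (intro mult_nonneg_nonneg) (auto simp: abs_square_less_1 abs_less_iff)
    ultimately show ?thesis by (simp add: power2_eq_square power3_eq_cube algebra_simps)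
  qed
qed simp_all

text \<open>For \<zeta> = c + i s the squared modulus of 1 + sin \<zeta> is (sin c + cosh s)^2. Both
  tests on the circle then reduce to concavity of the sine on [0, 1] and cosh^2 s \<ge> 1 +
  s^2.\<close>

lemma best_bound_sine:
  "best_bound (\<lambda>z. 1 + sin z) (8 * (1 + sin 1) / (9 * sin 1))"
proof (rule best_boundI_right[where M = "1 + sin 1"
      and f = "\<lambda>z. Arcsin (extremal (8 * (1 + sin 1) / (9 * sin 1)) z - 1)"])
  define b \<sigma> :: real where "b = 8 * (1 + sin 1) / (9 * sin 1)" and "\<sigma> = sin 1"
  have \<sigma>: "5 / 6 \<le> \<sigma>" "\<sigma> \<le> 1"
    using Maclaurin_sin_bound[of 1 3] by (simp_all add: \<sigma>_def numeral_eq_Suc sin_coeff_def)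
  show M: "1 < 1 + sin (1::real)" "1 + sin (1::real) < 5"
    using \<sigma> unfolding \<sigma>_def by linarith+
  show beq: "8 * (1 + sin 1) / (9 * sin 1) = 8 * (1 + sin 1) / (9 * (1 + sin 1 - (1::real)))" by simp
  have b10: "10 / 9 < b" using \<sigma> by (simp add: b_def \<sigma>_def[symmetric] less_divide_eq)
  show "(\<lambda>z::complex. 1 + sin z) holomorphic_on ball 0 1" by (intro holomorphic_intros)
  have real: "\<bar>Re (extremal b z - 1)\<bar> < 1"
    if z: "norm z < 1" and im: "Im (extremal b z - 1) = 0" for z
  proof -
    have "1 / 2 < Re (extremal b z)" using Re_extremal_gt_half[of b z] z b10 by simp
    moreover have "Re (extremal b z) < 1 + \<sigma>"
      unfolding \<sigma>_def by (rule Re_extremal_less[OF M]) (use z im beq in \<open>simp_all add: b_def\<close>)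
    ultimately show ?thesis using \<sigma> unfolding minus_complex.simps one_complex.simps by linarith
  qed
  show "(\<lambda>z. Arcsin (extremal (8 * (1 + sin 1) / (9 * sin 1)) z - 1)) holomorphic_on ball 0 1"
    unfolding b_def[symmetric]
  proof (rule holomorphic_on_compose_gen[unfolded o_def, where g = Arcsin])
    show "(\<lambda>z. extremal b z - 1) holomorphic_on ball 0 1"
      using b10 by (intro holomorphic_intros holomorphic_extremal) auto
    show "Arcsin holomorphic_on (\<lambda>z. extremal b z - 1) ` ball 0 1"
      using real by (intro holomorphic_on_Arcsin) auto
  qed auto
  show "10 / 9 * norm (1 + sin \<zeta>) \<le> 8 * (1 + sin 1) / (9 * sin 1) * norm (1 + sin \<zeta> - 1)
     \<or> Re (1 / (1 + sin \<zeta>)) \<le> 1 / (1 + sin 1) \<or>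
     (\<forall>z. norm z < 1 \<longrightarrow> nephroid_primitive z \<noteq>
        of_real (8 * (1 + sin 1) / (9 * sin 1)) * (1 - 1 / (1 + sin \<zeta>)))"
    if \<zeta>: "norm \<zeta> = 1" for \<zeta> :: complex
  proof -
    define c s where "c = Re \<zeta>" and "s = Im \<zeta>"
    \<comment> \<open>\<open>C\<close> and \<open>T\<close> are cosh s and sinh s.\<close>
    define S C T where "S = sin c" and "C = (exp s + exp (- s)) / 2" and "T = (exp s - exp (- s)) / 2"
    have s2: "s\<^sup>2 = 1 - c\<^sup>2" and c1: "-1 \<le> c" "c \<le> 1"
      using unit_circle_Im[OF \<zeta>] unit_circle_Re[OF \<zeta>] by (auto simp: c_def s_def)
    have CT: "C\<^sup>2 = 1 + T\<^sup>2"
      by (simp add: C_def T_def power2_eq_square field_simps flip: exp_add)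
    have C1: "1 + s\<^sup>2 / 2 \<le> C"
    proof -
      have *: "1 + t\<^sup>2 / 2 \<le> (exp t + exp (- t)) / 2" for t :: real
      proof -
        obtain u v where "exp t = (\<Sum>m<4. t ^ m / fact m) + exp u / fact 4 * t ^ 4"
          "exp (- t) = (\<Sum>m<4. (- t) ^ m / fact m) + exp v / fact 4 * (- t) ^ 4"
          using Maclaurin_exp_le[of t 4] Maclaurin_exp_le[of "- t" 4] by blast
        then have "exp t + exp (- t) = 2 + t\<^sup>2 + (exp u + exp v) / 24 * t ^ 4"
          by (simp add: numeral_eq_Suc field_simps)
        moreover have "0 \<le> (exp u + exp v) / 24 * t ^ 4" by simp
        ultimately show ?thesis by simp
      qed
      show ?thesis unfolding C_def by (rule *)
    qed
    have C2: "1 + s\<^sup>2 \<le> C\<^sup>2"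
    proof -
      have "(1 + s\<^sup>2 / 2)\<^sup>2 \<le> C\<^sup>2" using C1 by (intro power_mono) auto
      moreover have "(1 + s\<^sup>2 / 2)\<^sup>2 = 1 + s\<^sup>2 + (s\<^sup>2 / 2)\<^sup>2"
        by (simp add: power2_eq_square algebra_simps)
      ultimately show ?thesis using zero_le_power2[of "s\<^sup>2 / 2"] by linarith
    qed
    have "1 \<le> C" using C1 zero_le_power2[of s] by linarith
    have cos2: "(cos c)\<^sup>2 = 1 - S\<^sup>2" by (simp add: S_def cos_squared_eq)
    have Re\<phi>: "Re (sin \<zeta>) = S * C" and Im\<phi>: "Im (sin \<zeta>) = cos c * T"
      by (simp_all add: Re_sin Im_sin S_def C_def T_def c_def s_def)
    have T2: "T\<^sup>2 = C\<^sup>2 - 1" using CT by simp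
    have nsin: "(norm (sin \<zeta>))\<^sup>2 = S\<^sup>2 + C\<^sup>2 - 1"
      unfolding cmod_power2 Re\<phi> Im\<phi> power_mult_distrib cos2 T2 by (simp add: algebra_simps)
    have n\<phi>: "(norm (1 + sin \<zeta>))\<^sup>2 = (S + C)\<^sup>2"
    proof -
      have "(norm (1 + sin \<zeta>))\<^sup>2 = 1 + 2 * (S * C) + ((S * C)\<^sup>2 + (cos c * T)\<^sup>2)"
        unfolding cmod_power2 plus_complex.simps Re\<phi> Im\<phi> by (simp add: power2_eq_square algebra_simps)
      also have "(S * C)\<^sup>2 + (cos c * T)\<^sup>2 = S\<^sup>2 + C\<^sup>2 - 1"
        unfolding power_mult_distrib cos2 T2 by (simp add: algebra_simps)
      finally show ?thesis by (simp add: power2_eq_square algebra_simps)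
    qed
    have chord: "x * \<sigma> \<le> sin x" if "0 \<le> x" "x \<le> 1" for x
    proof -
      have "convex_on {0..1} (\<lambda>x. - sin x)"
      proof (rule f''_ge0_imp_convex)
        show "((\<lambda>x. - sin x) has_real_derivative - cos x) (at x)" for x
          by (auto intro!: derivative_eq_intros)
        show "((\<lambda>x. - cos x) has_real_derivative sin x) (at x)" for x
          by (auto intro!: derivative_eq_intros)
        show "0 \<le> sin x" if "x \<in> {0..1}" for x :: real
          using that pi_ge_two by (intro sin_ge_zero) auto
      qed auto
      from convex_onD[OF this, of x 0 1] that show ?thesis by (simp add: \<sigma>_def)
    qed
    show ?thesis
    proof (cases "0 \<le> c")
      case True
      have S: "c * \<sigma> \<le> S" using chord[OF True c1(2)] by (simp add: S_def)
      then have S0: "0 \<le> S" using True \<sigma> by (intro order_trans[OF _ S] mult_nonneg_nonneg) auto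
      have S2: "(c * \<sigma>)\<^sup>2 \<le> S\<^sup>2" using S True \<sigma> by (intro power_mono) auto
      have "(1 - \<sigma>) * (c * \<sigma>) \<le> (1 - \<sigma>) * (S * C)"
      proof (intro mult_left_mono)
        have "S * 1 \<le> S * C" using S0 \<open>1 \<le> C\<close> by (intro mult_left_mono)
        then show "c * \<sigma> \<le> S * C" using S by simp
      qed (use \<sigma> in simp)
      \<comment> \<open>This is what remains of (S + C)^2 - (1 + \<sigma>)(1 + S C) after S is
        replaced by its chord c \<sigma>, C^2 by 2 - c^2, and S C by c \<sigma>.\<close>
      moreover have "0 \<le> (1 - c) * ((1 - \<sigma>) + c * (1 - \<sigma>\<^sup>2))"
        using True c1 \<sigma> by (intro mult_nonneg_nonneg add_nonneg_nonneg) (auto simp: power_le_one)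
      ultimately have "(1 + \<sigma>) * (1 + S * C) \<le> (S + C)\<^sup>2"
        using S2 C2 unfolding s2 by (simp add: power2_eq_square algebra_simps)
      then show ?thesis
        using Re_one_divide_le[of "1 + \<sigma>" "1 + sin \<zeta>"] \<sigma> n\<phi> Re\<phi> by (simp add: \<sigma>_def)
    next
      case False
      have "(- c) * \<sigma> \<le> - S" using chord[of "- c"] False c1 by (simp add: S_def)
      moreover have "(- c) * (5 / 6) \<le> (- c) * \<sigma>" using False \<sigma> by (intro mult_left_mono) auto
      ultimately have S: "(- c) * (5 / 6) \<le> - S" by linarith
      have "((- c) * (5 / 6))\<^sup>2 \<le> (- S)\<^sup>2" by (rule power_mono[OF S]) (use False in auto)
      then have S2: "25 / 36 * c\<^sup>2 \<le> S\<^sup>2" by (simp add: power_mult_distrib power_divide)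
      have "S \<le> 0" using S False by auto
      then have SC: "S * C \<le> 0" using \<open>1 \<le> C\<close> by (simp add: mult_nonpos_nonneg)
      have c2: "c\<^sup>2 \<le> 1" using c1 by (simp add: abs_square_le_1)
      \<comment> \<open>The factor 5/8 is the ratio of 10/9 to 16/9, and b \<ge> 16/9 because
        \<sigma> \<le> 1.\<close>
      have "(5 / 8)\<^sup>2 * (S + C)\<^sup>2 \<le> S\<^sup>2 + C\<^sup>2 - 1"
      proof -
        have "(5 / 8)\<^sup>2 * (S + C)\<^sup>2 = 25 / 64 * (S\<^sup>2 + C\<^sup>2) + 25 / 32 * (S * C)"
          by (simp add: power2_eq_square field_simps)
        moreover have "1 + (1 - c\<^sup>2) \<le> C\<^sup>2" using C2 s2 by simp
        ultimately show ?thesis using SC S2 c2 by (simp add: field_simps)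
      qed
      then have "(5 / 8 * norm (1 + sin \<zeta>))\<^sup>2 \<le> (norm (sin \<zeta>))\<^sup>2"
        unfolding nsin power_mult_distrib n\<phi> .
      then have "5 / 8 * norm (1 + sin \<zeta>) \<le> norm (sin \<zeta>)" by (rule power2_le_imp_le) simp
      moreover have "16 / 9 \<le> b" using \<sigma> by (simp add: b_def \<sigma>_def[symmetric] le_divide_eq)
      then have "16 / 9 * norm (sin \<zeta>) \<le> b * norm (sin \<zeta>)" by (intro mult_right_mono) auto
      ultimately show ?thesis unfolding b_def[symmetric] by simp
    qed
  qed
  show "Re (1 + sin w) \<le> 1 + sin 1" if w: "norm w < 1" and im: "Im (1 + sin w) = 0" for w
  proof -
    have x: "\<bar>Re w\<bar> < 1" using w abs_Re_le_cmod[of w] by linarith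
    then have "0 < cos (Re w)" using pi_ge_two by (intro cos_gt_zero_pi) auto
    then have "exp (Im w) = exp (- Im w)" using im by (simp add: Im_sin)
    then have "Im w = 0" by simp
    moreover have "sin (Re w) \<le> sin 1" using x pi_ge_two by (intro sin_monotone_2pi_le) auto
    ultimately show ?thesis by (simp add: Re_sin)
  qed
qed simp_all

text \<open>The boundary curves of the two regions have a contact of fourth order at the point \<open>8/9\<close>,
  so for the exponential function a half-plane does not separate them.\<close>

lemma nephroid_primitive_quartic:
  assumes z: "norm z < 1"
  shows "Re (nephroid_primitive z) + 2 / 5 * Im (nephroid_primitive z) ^ 4 < 8 / 9"
proof -
  define x y where "x = Re z" and "y = Im z"
  have xy: "x\<^sup>2 + y\<^sup>2 < 1"
    using z cmod_power2[of z] abs_square_less_1[of "norm z"] by (simp add: x_def y_def)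
  have x2: "x\<^sup>2 < 1" using xy zero_le_power2[of y] by linarith
  then have x1: "\<bar>x\<bar> < 1" by (simp add: abs_square_less_1)
  \<comment> \<open>The largest value of 1 - x^2/3 + y^2/9 when y^2 \<le> 1 - x^2.\<close>
  define m where "m = (10 - 4 * x\<^sup>2) / 9"
  have m: "0 \<le> m" using x2 by (simp add: m_def)
  have "Im (nephroid_primitive z) = y * (1 - x\<^sup>2 / 3 + y\<^sup>2 / 9)"
    by (simp add: nephroid_primitive_Re_Im x_def y_def power2_eq_square power3_eq_cube field_simps)
  then have Im2: "(Im (nephroid_primitive z))\<^sup>2 = y\<^sup>2 * (1 - x\<^sup>2 / 3 + y\<^sup>2 / 9)\<^sup>2"
    by (simp add: power_mult_distrib)
  have "(1 - x\<^sup>2 / 3 + y\<^sup>2 / 9)\<^sup>2 \<le> m\<^sup>2"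
  proof (rule power_mono)
    show "1 - x\<^sup>2 / 3 + y\<^sup>2 / 9 \<le> m" using xy by (simp add: m_def field_simps)
    show "0 \<le> 1 - x\<^sup>2 / 3 + y\<^sup>2 / 9" using x2 zero_le_power2[of y] by linarith
  qed
  then have Im2_le: "(Im (nephroid_primitive z))\<^sup>2 \<le> (1 - x\<^sup>2) * m\<^sup>2"
    unfolding Im2 using xy x2 by (intro mult_mono) auto
  have "((Im (nephroid_primitive z))\<^sup>2)\<^sup>2 \<le> ((1 - x\<^sup>2) * m\<^sup>2)\<^sup>2"
    by (rule power_mono[OF Im2_le]) simp
  then have Im4: "Im (nephroid_primitive z) ^ 4 \<le> (1 - x\<^sup>2)\<^sup>2 * (m\<^sup>2)\<^sup>2"
    by (simp add: power_mult_distrib flip: power_mult)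
  show ?thesis
  proof (cases "0 \<le> x")
    case True
    have Re_le: "Re (nephroid_primitive z) \<le> 4 / 3 * x - 4 / 9 * x ^ 3"
      using Re_nephroid_primitive_le[OF z] True by (simp add: x_def)
    \<comment> \<open>After cancelling (1 - x)^2, the square of the left-hand side has to stay below
      10/9 (2 + x). The line lies slightly below the chord over [0, 1] of the concave function sqrt
      (10/9 (2 + x)).\<close>
    have poly: "(1 + x) * m\<^sup>2 \<le> 149 / 100 + 33 / 100 * x"
    proof -
      have "x ^ 4 \<le> x ^ 3" "x ^ 5 \<le> x ^ 3" using True x1 by (auto intro!: power_decreasing)
      moreover have "0 \<le> x ^ 3" using True by simp
      moreover have "0 \<le> x\<^sup>2 - 91 / 100 * x + 8281 / 40000"
        using zero_le_power2[of "x - 91 / 200"] by (simp add: power2_eq_square field_simps)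
      moreover have "81 * ((1 + x) * m\<^sup>2) = 100 + 100 * x - 80 * x\<^sup>2 - 80 * x ^ 3 + 16 * x ^ 4 + 16 * x ^ 5"
        by (simp add: m_def power2_eq_square field_simps numeral_eq_Suc)
      ultimately show ?thesis using True x1 by linarith
    qed
    have "((1 + x) * m\<^sup>2)\<^sup>2 \<le> (149 / 100 + 33 / 100 * x)\<^sup>2"
      using True by (intro power_mono[OF poly]) simp
    also have "\<dots> < 10 / 9 * (2 + x)"
    proof -
      have "x * x \<le> x * 1" using True x1 by (intro mult_left_mono) auto
      then show ?thesis using True x1 by (simp add: power2_eq_square field_simps)
    qed
    finally have "((1 + x) * m\<^sup>2)\<^sup>2 < 10 / 9 * (2 + x)" .
    then have "(1 - x)\<^sup>2 * ((1 + x) * m\<^sup>2)\<^sup>2 < (1 - x)\<^sup>2 * (10 / 9 * (2 + x))"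
      using x1 by (intro mult_strict_left_mono) auto
    also have "(1 - x)\<^sup>2 * ((1 + x) * m\<^sup>2)\<^sup>2 = (1 - x\<^sup>2)\<^sup>2 * (m\<^sup>2)\<^sup>2"
    proof -
      have "1 - x\<^sup>2 = (1 - x) * (1 + x)" by (simp add: power2_eq_square algebra_simps)
      then show ?thesis by (simp only: power_mult_distrib mult.assoc)
    qed
    finally have "2 / 5 * Im (nephroid_primitive z) ^ 4 < 2 / 5 * ((1 - x)\<^sup>2 * (10 / 9 * (2 + x)))"
      using Im4 by simp
    also have "\<dots> = 8 / 9 - (4 / 3 * x - 4 / 9 * x ^ 3)"
      by (simp add: power2_eq_square power3_eq_cube field_simps)
    finally show ?thesis using Re_le by linarith
  next
    case False
    have "Re (nephroid_primitive z) = x * (1 - x\<^sup>2 / 9 + y\<^sup>2 / 3)"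
      by (simp add: nephroid_primitive_Re_Im x_def y_def power2_eq_square power3_eq_cube field_simps)
    moreover have "0 \<le> 1 - x\<^sup>2 / 9 + y\<^sup>2 / 3" using x2 zero_le_power2[of y] by linarith
    ultimately have "Re (nephroid_primitive z) \<le> 0" using False by (simp add: mult_nonpos_nonneg)
    moreover have "\<bar>Im (nephroid_primitive z)\<bar> ^ 4 \<le> (10 / 9) ^ 4"
      using norm_nephroid_primitive_less[OF z] abs_Im_le_cmod[of "nephroid_primitive z"]
      by (intro power_mono) auto
    then have "2 / 5 * Im (nephroid_primitive z) ^ 4 \<le> 2 / 5 * (10 / 9) ^ 4" by simp
    moreover have "2 / 5 * (10 / 9) ^ 4 < (8 / 9 :: real)" by (simp add: power_divide)
    ultimately show ?thesis by linarith
  qed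
qed

lemma cos_le_quartic: "cos (x::real) \<le> 1 - x\<^sup>2 / 2 + x ^ 4 / 24"
proof -
  obtain t where "cos x = (\<Sum>m<4. cos_coeff m * x ^ m) + cos (t + 1 / 2 * real 4 * pi) / fact 4 * x ^ 4"
    using Maclaurin_cos_expansion[of x 4] by blast
  moreover have "(\<Sum>m<4. cos_coeff m * x ^ m) = 1 - x\<^sup>2 / 2"
  proof -
    have "{..<4::nat} = {0, 1, 2, 3}" by auto
    then show ?thesis by (simp add: cos_coeff_def)
  qed
  moreover have "cos (t + 1 / 2 * real 4 * pi) / fact 4 * x ^ 4 \<le> 1 / 24 * x ^ 4"
    by (intro mult_right_mono) (auto simp: fact_numeral)
  ultimately show ?thesis by linarith
qed

lemma abs_sin_ge_cubic:
  assumes "\<bar>x\<bar> \<le> 1" shows "\<bar>x\<bar> * (1 - x\<^sup>2 / 6) \<le> \<bar>sin (x::real)\<bar>"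
proof -
  have *: "x * (1 - x\<^sup>2 / 6) \<le> sin x" if "0 \<le> x" for x :: real
  proof -
    have "\<bar>sin x - x\<bar> \<le> x ^ 3 / 6"
      using Maclaurin_sin_bound[of x 3] that by (simp add: eval_nat_numeral sin_coeff_def)
    then have "x - x ^ 3 / 6 \<le> sin x" by linarith
    then show ?thesis by (simp add: power2_eq_square power3_eq_cube algebra_simps)
  qed
  show ?thesis
  proof (cases "0 \<le> x")
    case True
    then show ?thesis using *[of x] by simp
  next
    case False
    then show ?thesis using *[of "- x"] by simp
  qed
qed

lemma exp_ge_cubic: "1 + x + x\<^sup>2 / 2 + x ^ 3 / 6 \<le> exp (x::real)"
proof -
  obtain t where "exp x = (\<Sum>m<4. x ^ m / fact m) + exp t / fact 4 * x ^ 4"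
    using Maclaurin_exp_le[of x 4] by blast
  moreover have "0 \<le> exp t / fact 4 * x ^ 4" by simp
  moreover have "(\<Sum>m<4. x ^ m / fact m) = 1 + x + x\<^sup>2 / 2 + x ^ 3 / 6"
    by (simp add: numeral_eq_Suc)
  ultimately show ?thesis by linarith
qed

text \<open>For \<zeta> on the unit circle, d = 1 - Re \<zeta> and s = Im \<zeta>. Multiplied by exp
  d, the inequality controls by how much the curve b (1 - exp (-\<zeta>)) fails to reach Re = 8/9,
  in terms of the fourth power of its imaginary part. To leading order cos s - exp (-d) is d^2/6 and
  sin^4 s is 4 d^2, so the factor must be at least 1/24; 52/1000 is 2/5 times 13/100, with 13/100 a
  lower bound for (b/e)^3.\<close>

lemma cos_exp_circle_bound:
  fixes d s :: real
  assumes d: "0 \<le> d" "d \<le> 1" and s: "s\<^sup>2 = d * (2 - d)"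
  shows "cos s \<le> exp (- d) + 52 / 1000 * exp (3 * d) * sin s ^ 4"
proof -
  define \<sigma> where "\<sigma> = d * (2 - d)"
  have \<sigma>: "0 \<le> \<sigma>" "\<sigma> \<le> 1"
  proof -
    show "0 \<le> \<sigma>" using d by (simp add: \<sigma>_def)
    have "1 - \<sigma> = (1 - d)\<^sup>2" by (simp add: \<sigma>_def power2_eq_square algebra_simps)
    then show "\<sigma> \<le> 1" using zero_le_power2[of "1 - d"] by linarith
  qed
  have s1: "\<bar>s\<bar> \<le> 1" using abs_square_le_1[of s] s \<sigma> by (simp add: \<sigma>_def)
  have "s ^ 4 = (s\<^sup>2)\<^sup>2" by (simp flip: power_mult)
  then have s4: "s ^ 4 = d\<^sup>2 * (2 - d)\<^sup>2" by (simp add: s power_mult_distrib)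
  have "(\<bar>s\<bar> * (1 - s\<^sup>2 / 6)) ^ 4 \<le> \<bar>sin s\<bar> ^ 4"
    using abs_sin_ge_cubic[OF s1] s1 \<sigma> s by (intro power_mono) (auto simp flip: \<sigma>_def)
  then have sin4: "d\<^sup>2 * ((2 - d) * (1 - \<sigma> / 6)\<^sup>2)\<^sup>2 \<le> sin s ^ 4"
    by (simp add: power_mult_distrib s4 s \<sigma>_def flip: power_mult)
  have q: "1 - \<sigma> / 3 \<le> (1 - \<sigma> / 6)\<^sup>2" by (simp add: power2_eq_square field_simps)
  \<comment> \<open>The cubic Taylor polynomial of exp (3 d / 2), half of the exponent 3 d, because
    the estimate is squared afterwards.\<close>
  define E where "E = 1 + 3 / 2 * d + 9 / 8 * d\<^sup>2 + 9 / 16 * d ^ 3"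
  have E: "E \<le> exp (3 / 2 * d)"
    using exp_ge_cubic[of "3 / 2 * d"] by (simp add: E_def power_mult_distrib power_divide)
  have E0: "0 \<le> E" using d by (simp add: E_def)
  have prod: "2 + d / 3 \<le> E * ((2 - d) * (1 - \<sigma> / 3))"
  proof -
    have "d ^ 4 \<le> d ^ 2" "d ^ 6 \<le> d ^ 5" using d by (auto intro!: power_decreasing)
    moreover have "0 \<le> d ^ 3" "0 \<le> d ^ 5" "d\<^sup>2 \<le> d" using d by (auto simp: power2_eq_square mult_left_le)
    moreover have "3 * (E * ((2 - d) * (1 - \<sigma> / 3))) = 6 + 2 * d + d\<^sup>2 / 4 + d ^ 3 / 2
       - 15 / 16 * d ^ 4 + 9 / 8 * d ^ 5 - 9 / 16 * d ^ 6"
      by (simp add: E_def \<sigma>_def numeral_eq_Suc field_simps)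
    ultimately show ?thesis using d(1) by linarith
  qed
  have "2 + d / 3 \<le> exp (3 / 2 * d) * ((2 - d) * (1 - \<sigma> / 6)\<^sup>2)"
    using d \<sigma> q E0 by (intro order_trans[OF prod] mult_mono[OF E] mult_left_mono mult_nonneg_nonneg) auto
  then have "(2 + d / 3)\<^sup>2 \<le> (exp (3 / 2 * d) * ((2 - d) * (1 - \<sigma> / 6)\<^sup>2))\<^sup>2"
    using d by (intro power_mono) auto
  also have "\<dots> = exp (3 * d) * ((2 - d) * (1 - \<sigma> / 6)\<^sup>2)\<^sup>2"
    unfolding power_mult_distrib[of "exp _"] by (simp flip: exp_double)
  finally have "d\<^sup>2 * (2 + d / 3)\<^sup>2 \<le> d\<^sup>2 * (exp (3 * d) * ((2 - d) * (1 - \<sigma> / 6)\<^sup>2)\<^sup>2)"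
    by (intro mult_left_mono) auto
  also have "\<dots> = exp (3 * d) * (d\<^sup>2 * ((2 - d) * (1 - \<sigma> / 6)\<^sup>2)\<^sup>2)" by (simp only: mult_ac)
  also have "\<dots> \<le> exp (3 * d) * sin s ^ 4" using sin4 by (intro mult_left_mono) auto
  finally have main: "d\<^sup>2 * (2 + d / 3)\<^sup>2 \<le> exp (3 * d) * sin s ^ 4" .
  have "d\<^sup>2 / 6 + d ^ 4 / 24 \<le> 52 / 1000 * (d\<^sup>2 * (2 + d / 3)\<^sup>2)"
  proof -
    have "d * d \<le> d" using d by (simp add: mult_left_le)
    then have "1 / 6 + d\<^sup>2 / 24 \<le> 52 / 1000 * (2 + d / 3)\<^sup>2"
      using d by (simp add: power2_eq_square field_simps)
    then have "d\<^sup>2 * (1 / 6 + d\<^sup>2 / 24) \<le> d\<^sup>2 * (52 / 1000 * (2 + d / 3)\<^sup>2)"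
      by (intro mult_left_mono) auto
    then show ?thesis by (simp add: power2_eq_square numeral_eq_Suc algebra_simps)
  qed
  moreover have "cos s \<le> 1 - d + d\<^sup>2 / 2 - d ^ 3 / 6 + (d\<^sup>2 / 6 + d ^ 4 / 24)"
    using cos_le_quartic[of s] unfolding s s4 by (simp add: numeral_eq_Suc field_simps)
  moreover have "1 - d + d\<^sup>2 / 2 - d ^ 3 / 6 \<le> exp (- d)"
    using exp_ge_cubic[of "- d"] by simp
  ultimately show ?thesis using main by simp
qed

text \<open>Near 8/9 the curve b (1 - exp (-\<zeta>)) recedes from the line Re = 8/9 by about 0.301
  Im^4, the boundary of the range of H by 27/16 Im^4. At z = i the latter allows no factor above
  (8/9)/(10/9)^4, about 0.583. The factor 2/5 in the separating quartic lies between 0.301 and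
  0.583.\<close>

lemma best_bound_exp: "best_bound (\<lambda>z. exp z) (8 * exp 1 / (9 * (exp 1 - 1)))"
proof (rule best_boundI_right[where M = "exp 1"
      and f = "\<lambda>z. Ln (extremal (8 * exp 1 / (9 * (exp 1 - 1))) z)"])
  define b e :: real where "b = 8 * exp 1 / (9 * (exp 1 - 1))" and "e = exp 1"
  have e: "2 \<le> e" "e < 272 / 100"
    using exp_ge_add_one_self[of 1] e_less_272 by (simp_all add: e_def)
  have beq: "b = 8 * e / (9 * (e - 1))" by (simp add: b_def e_def)
  have b10: "10 / 9 < b" using e by (simp add: beq less_divide_eq)
  have Re_v: "1 / 2 < Re (extremal b z)" if "norm z < 1" for z
    using Re_extremal_gt_half[of b z] b10 that by simp
  show "1 < exp (1::real)" "exp (1::real) < 5" using e by (simp_all add: e_def)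
  show "(\<lambda>z::complex. exp z) holomorphic_on ball 0 1" by (intro holomorphic_intros)
  show "(\<lambda>z. Ln (extremal (8 * exp 1 / (9 * (exp 1 - 1))) z)) holomorphic_on ball 0 1"
    unfolding b_def[symmetric] using Re_v b10
    by (intro holomorphic_intros holomorphic_extremal nonpos_Reals_notI) force+
  show "exp (Ln (extremal (8 * exp 1 / (9 * (exp 1 - 1))) z)) = extremal (8 * exp 1 / (9 * (exp 1 - 1))) z"
    if "norm z < 1" for z
    unfolding b_def[symmetric] using Re_v[OF that] by (intro exp_Ln) auto
  show "10 / 9 * norm (exp \<zeta>) \<le> 8 * exp 1 / (9 * (exp 1 - 1)) * norm (exp \<zeta> - 1)
     \<or> Re (1 / exp \<zeta>) \<le> 1 / exp 1 \<or>
     (\<forall>z. norm z < 1 \<longrightarrow> nephroid_primitive z \<noteq>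
        of_real (8 * exp 1 / (9 * (exp 1 - 1))) * (1 - 1 / exp \<zeta>))"
    if \<zeta>: "norm \<zeta> = 1" for \<zeta> :: complex
  proof -
    define c s where "c = Re \<zeta>" and "s = Im \<zeta>"
    have s2: "s\<^sup>2 = 1 - c\<^sup>2" and c1: "-1 \<le> c" "c \<le> 1"
      using unit_circle_Im[OF \<zeta>] unit_circle_Re[OF \<zeta>] by (auto simp: c_def s_def)
    have s1: "\<bar>s\<bar> \<le> 1" using s2 zero_le_power2[of c] by (simp add: abs_square_le_1[symmetric])
    have inv: "1 / exp \<zeta> = exp (- \<zeta>)" by (simp add: exp_minus inverse_eq_divide)
    have Re_inv: "Re (exp (- \<zeta>)) = exp (- c) * cos s" and Im_inv: "Im (exp (- \<zeta>)) = - (exp (- c) * sin s)"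
      by (simp_all add: Re_exp Im_exp c_def s_def)
    show ?thesis
    proof (cases "0 \<le> c")
      case True
      define d where "d = 1 - c"
      have d: "0 \<le> d" "d \<le> 1" and sd: "s\<^sup>2 = d * (2 - d)"
        using c1 True s2 by (auto simp: d_def power2_eq_square algebra_simps)
      have "nephroid_primitive z \<noteq> of_real b * (1 - exp (- \<zeta>))" if z: "norm z < 1" for z
      proof
        assume eq: "nephroid_primitive z = of_real b * (1 - exp (- \<zeta>))"
        have "Re (nephroid_primitive z) = b * (1 - exp (- c) * cos s)"
          "Im (nephroid_primitive z) = b * (exp (- c) * sin s)"
          unfolding eq by (simp_all add: Re_inv Im_inv)
        with nephroid_primitive_quartic[OF z]
        have lt: "b * (1 - exp (- c) * cos s) + 2 / 5 * (b * (exp (- c) * sin s)) ^ 4 < 8 / 9" by simp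
        have ec: "exp (- c) = exp d / e"
          by (simp add: d_def e_def exp_diff exp_minus field_simps)
        have "exp d * cos s \<le> exp d * (exp (- d) + 52 / 1000 * exp (3 * d) * sin s ^ 4)"
          using cos_exp_circle_bound[OF d sd] by (intro mult_left_mono) auto
        also have "\<dots> = 1 + 52 / 1000 * (exp d * sin s) ^ 4"
        proof -
          have "exp d * exp (- d) = 1" by (simp flip: exp_add)
          moreover have "exp d * exp (3 * d) = exp d ^ 4"
            by (simp flip: exp_add exp_of_nat_mult)
          ultimately show ?thesis by (simp add: power_mult_distrib distrib_left)
        qed
        finally have key: "exp d * cos s - 1 \<le> 52 / 1000 * (exp d * sin s) ^ 4" by simp
        have be: "b / e = 8 / (9 * (e - 1))" using e by (simp add: beq)
        \<comment> \<open>From e < 2.72 one gets b/e = 8/(9 (e - 1)) \<ge> 0.516, whose cube exceeds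
          the 13/100 built into 52/1000.\<close>
        have "(516 / 1000) ^ 3 \<le> (b / e) ^ 3"
          unfolding be using e by (intro power_mono) (simp_all add: le_divide_eq)
        moreover have "13 / 100 \<le> (516 / 1000 :: real) ^ 3" by (simp add: power_divide)
        ultimately have be3: "52 / 1000 \<le> 2 / 5 * (b / e) ^ 3" by linarith
        have "b / e * (exp d * cos s - 1) \<le> b / e * (2 / 5 * (b / e) ^ 3 * (exp d * sin s) ^ 4)"
        proof (rule mult_left_mono)
          show "exp d * cos s - 1 \<le> 2 / 5 * (b / e) ^ 3 * (exp d * sin s) ^ 4"
            using key mult_right_mono[OF be3, of "(exp d * sin s) ^ 4"] by simp
        qed (use b10 e in auto)
        also have "\<dots> = 2 / 5 * (b * (exp (- c) * sin s)) ^ 4"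
        proof -
          have "B * (2 / 5 * B ^ 3 * Y ^ 4) = 2 / 5 * (B * Y) ^ 4" for B Y :: real
            by (simp add: power_mult_distrib numeral_eq_Suc)
          moreover have "b * (exp (- c) * sin s) = b / e * (exp d * sin s)" unfolding ec by simp
          ultimately show ?thesis by (simp only:)
        qed
        finally have "b / e * (exp d * cos s - 1) \<le> 2 / 5 * (b * (exp (- c) * sin s)) ^ 4" .
        moreover have "b * (1 - exp (- c) * cos s) = 8 / 9 - b / e * (exp d * cos s - 1)"
        proof -
          have "b - b / e = (e - 1) * (b / e)" using e by (simp add: left_diff_distrib diff_divide_distrib)
          moreover have "(e - 1) * (b / e) = 8 / 9" unfolding be using e by (simp add: divide_eq_eq)
          ultimately have "8 / 9 = b - b / e" by simp
          then show ?thesis unfolding ec by (simp add: algebra_simps)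
        qed
        ultimately show False using lt by linarith
      qed
      then show ?thesis unfolding inv b_def[symmetric] by blast
    next
      case False
      define g where "g = - c"
      have g: "0 \<le> g" "g \<le> 1" using False c1 by (auto simp: g_def)
      have sg: "s\<^sup>2 = 1 - g\<^sup>2" using s2 by (simp add: g_def)
      have g2: "g\<^sup>2 \<le> 1" using g by (simp add: power_le_one)
      have "exp (- c) \<ge> 1 + g + g\<^sup>2 / 2"
        using exp_lower_Taylor_quadratic[OF g(1)] by (simp add: g_def)
      moreover have "cos s \<le> 1 - s\<^sup>2 / 2 + s\<^sup>2 * s\<^sup>2 / 24"
        using cos_le_quartic[of s] by (simp add: numeral_eq_Suc)
      moreover have "s\<^sup>2 * s\<^sup>2 \<le> 1" using sg g2 by (intro mult_le_one) auto
      moreover have "(1 - g\<^sup>2) / 2 = 1 / 2 - g\<^sup>2 / 2" by (simp add: field_simps)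
      ultimately have "11 / 24 + g \<le> exp (- c) - cos s" unfolding sg by linarith
      then have "(11 / 24 + g)\<^sup>2 \<le> (exp (- c) - cos s)\<^sup>2" using g by (intro power_mono) auto
      moreover have "121 / 576 + g\<^sup>2 \<le> (11 / 24 + g)\<^sup>2" using g by (simp add: power2_eq_square field_simps)
      moreover have "25 / 36 * s\<^sup>2 \<le> (sin s)\<^sup>2"
      proof -
        have "(\<bar>s\<bar> * (5 / 6))\<^sup>2 \<le> \<bar>sin s\<bar>\<^sup>2"
        proof (rule power_mono)
          have "\<bar>s\<bar> * (5 / 6) \<le> \<bar>s\<bar> * (1 - s\<^sup>2 / 6)" using sg by (intro mult_left_mono) auto
          then show "\<bar>s\<bar> * (5 / 6) \<le> \<bar>sin s\<bar>" using abs_sin_ge_cubic[OF s1] by linarith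
        qed simp
        then show ?thesis by (simp add: power_mult_distrib power_divide)
      qed
      \<comment> \<open>For real E, |1 - E exp (i t)| = |E - exp (i t)|.\<close>
      moreover have "(norm (1 - exp (- \<zeta>)))\<^sup>2 = (exp (- c) - cos s)\<^sup>2 + (sin s)\<^sup>2"
      proof -
        have "(1 - E * C)\<^sup>2 + (E * S)\<^sup>2 = (E - C)\<^sup>2 + S\<^sup>2" if "S\<^sup>2 + C\<^sup>2 = 1" for E C S :: real
        proof -
          have "(1 - E * C)\<^sup>2 + (E * S)\<^sup>2 = 1 - 2 * E * C + E\<^sup>2 * (S\<^sup>2 + C\<^sup>2)"
            by (simp add: power2_eq_square algebra_simps)
          also have "\<dots> = (S\<^sup>2 + C\<^sup>2) - 2 * E * C + E\<^sup>2" unfolding that by simp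
          finally show ?thesis by (simp add: power2_eq_square algebra_simps)
        qed
        from this[of "sin s" "cos s" "exp (- c)"] show ?thesis
          unfolding cmod_power2 minus_complex.simps Re_inv Im_inv by simp
      qed
      moreover have "25 / 36 * (1 - g\<^sup>2) = 25 / 36 - 25 / 36 * g\<^sup>2" by (simp only: right_diff_distrib mult_1_right)
      ultimately have "25 / 36 \<le> (norm (1 - exp (- \<zeta>)))\<^sup>2"
        using g2 zero_le_power2[of g] unfolding sg by linarith
      then have "(5 / 6)\<^sup>2 \<le> (norm (1 - exp (- \<zeta>)))\<^sup>2" by (simp add: power_divide)
      then have "5 / 6 \<le> norm (1 - exp (- \<zeta>))" by (rule power2_le_imp_le) simp
      moreover have "4 / 3 \<le> b" using e by (simp add: beq le_divide_eq)
      ultimately have "4 / 3 * (5 / 6) \<le> b * norm (1 - exp (- \<zeta>))" using b10 by (intro mult_mono) auto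
      then have "10 / 9 * norm (exp \<zeta>) \<le> b * norm (1 - exp (- \<zeta>)) * norm (exp \<zeta>)"
        by (intro mult_right_mono) auto
      moreover have "exp \<zeta> - 1 = (1 - exp (- \<zeta>)) * exp \<zeta>"
        by (simp add: algebra_simps flip: exp_add)
      ultimately show ?thesis
        unfolding b_def[symmetric] by (simp only: norm_mult mult.assoc simp_thms)
    qed
  qed
  show "Re (exp w) \<le> exp 1" if "norm w < 1" for w :: complex
  proof -
    have "Re (exp w) \<le> exp (Re w)" using complex_Re_le_cmod[of "exp w"] by simp
    also have "\<dots> \<le> exp 1" using that complex_Re_le_cmod[of w] by simp
    finally show ?thesis .
  qed
qed simp_all

section \<open>The rational majorant\<close>

text \<open>At 1 the value \<phi>(1) = 2 would only demand b \<ge> 16/9. The binding point is -1: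
  \<phi>(-1) = 2 sqrt 2 - 2 is the number \<open>m\<close>, and 1 - 1/m = -1/(2 k) gives b = 16 k /
  9.\<close>

lemma best_bound_rational:
  "best_bound (\<lambda>z. let k = of_real (1 + sqrt 2) in 1 + z / k * ((k + z) / (k - z)))
     (16 / 9 * (1 + sqrt 2))"
proof -
  define k :: real where "k = 1 + sqrt 2"
  define K :: complex where "K = of_real k"
  define b where "b = 16 / 9 * k"
  define \<phi> where "\<phi> z = 1 + z / K * ((K + z) / (K - z))" for z
  define m where "m = 2 * sqrt 2 - 2"
  \<comment> \<open>The equation \<phi>(w) = 1/(1 - u) is (1 - u) w^2 + K w - K^2 u = 0. This is its
    root vanishing at u = 0, rationalised; the denominator is nonzero because a principal root has
    nonnegative real part.\<close>
  define f where "f z = (let u = nephroid_primitive z / of_real b in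
     2 * K * u / (1 + csqrt (1 + 4 * u - 4 * u\<^sup>2)))" for z
  have k: "24 / 10 < k" "k < 242 / 100" using sqrt2_bounds by (simp_all add: k_def)
  have kk: "k * k = 2 * k + 1" by (simp add: k_def algebra_simps)
  have K0: "K \<noteq> 0" using k by (simp add: K_def)
  have b10: "10 / 9 < b" using k by (simp add: b_def)
  have K_ne: "K \<noteq> z" if "norm z \<le> 1" for z
  proof
    assume "K = z"
    then have "norm K \<le> 1" using that by simp
    then show False using k by (simp add: K_def)
  qed
  have hol\<phi>: "\<phi> holomorphic_on ball 0 1"
    unfolding \<phi>_def [abs_def] using K0 K_ne by (intro holomorphic_intros) auto
  have nonpos: "1 + 4 * (nephroid_primitive z / of_real b) - 4 * (nephroid_primitive z / of_real b)\<^sup>2 \<notin> \<real>\<^sub>\<le>\<^sub>0"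
    if z: "norm z < 1" for z
  proof
    define u where "u = nephroid_primitive z / of_real b"
    define x y where "x = Re u" and "y = Im u"
    assume "1 + 4 * (nephroid_primitive z / of_real b) - 4 * (nephroid_primitive z / of_real b)\<^sup>2 \<in> \<real>\<^sub>\<le>\<^sub>0"
    then have re: "1 + 4 * x - 4 * (x\<^sup>2 - y\<^sup>2) \<le> 0" and im: "y * (1 - 2 * x) = 0"
      by (auto simp: complex_nonpos_Reals_iff u_def[symmetric] x_def y_def power2_eq_square algebra_simps)
    have "\<bar>Re (nephroid_primitive z)\<bar> / b < 8 / 9 / b"
      using abs_Re_nephroid_primitive_less[OF z] b10 by (intro divide_strict_right_mono) auto
    also have "8 / 9 / b = k / 2 - 1"
    proof -
      have "8 / 9 = (k / 2 - 1) * b" using kk by (simp add: b_def algebra_simps)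
      moreover have "b \<noteq> 0" using b10 by simp
      ultimately show ?thesis by (metis nonzero_mult_div_cancel_right)
    qed
    finally have absx: "\<bar>x\<bar> < k / 2 - 1" using b10 by (simp add: x_def u_def)
    have x: "1 - k / 2 < x" using absx by linarith
    have "x < 1 / 2" using absx k by linarith
    then have "y = 0" using im \<open>x < 1 / 2\<close> by simp
    \<comment> \<open>As (k - 1)^2 = 2, the product is 1 + 4 x - 4 x^2. Its negative zero 1 - k/2 is
      exactly the edge -8/(9 b) of the strip.\<close>
    moreover have "0 < (k - 1 - (1 - 2 * x)) * (k - 1 + (1 - 2 * x))"
      using x \<open>x < 1 / 2\<close> k by (intro mult_pos_pos) auto
    ultimately show False using re kk by (simp add: power2_eq_square algebra_simps)
  qed
  have Re_denom: "1 + csqrt w \<noteq> 0" for w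
  proof
    assume "1 + csqrt w = 0"
    then have "1 + Re (csqrt w) = 0"
      unfolding complex_eq_iff plus_complex.simps one_complex.simps zero_complex.simps by (rule conjunct1)
    then show False using Re_csqrt[of w] by linarith
  qed
  have holf: "f holomorphic_on ball 0 1"
    unfolding f_def [abs_def] Let_def using nonpos Re_denom b10
    by (intro holomorphic_intros) auto
  have root: "f z * (K + f z) = K * (extremal b z - 1) * (K - f z)" if z: "norm z < 1" for z
  proof -
    define u where "u = nephroid_primitive z / of_real b"
    define q where "q = csqrt (1 + 4 * u - 4 * u\<^sup>2)"
    have u1: "1 - u \<noteq> 0" using extremal_denom_nonzero[of b z] b10 z by (simp add: u_def)
    have q2: "q\<^sup>2 = 1 + 4 * u - 4 * u\<^sup>2" by (simp add: q_def)
    have q1: "1 + q \<noteq> 0" using Re_denom by (simp add: q_def)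
    have f: "f z * (1 + q) = 2 * K * u" using q1 by (simp add: f_def Let_def u_def[symmetric] q_def)
    have v: "(extremal b z - 1) * (1 - u) = u"
      using u1 by (simp add: extremal_def u_def[symmetric] field_simps)
    have "((1 - u) * (f z * (K + f z)) - K * u * (K - f z)) * (1 + q)\<^sup>2
       = (1 - u) * (f z * (1 + q))\<^sup>2 + K * (1 + q) * (f z * (1 + q)) - K * K * u * (1 + q)\<^sup>2"
      by (simp add: power2_eq_square algebra_simps)
    also have "\<dots> = K * K * u * (4 * u * (1 - u) + 1 - q\<^sup>2)"
      unfolding f by (simp add: power2_eq_square algebra_simps)
    also have "\<dots> = 0" unfolding q2 by (simp add: power2_eq_square algebra_simps)
    finally have "(1 - u) * (f z * (K + f z)) = K * u * (K - f z)" using q1 by simp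
    also have "\<dots> = (1 - u) * (K * (extremal b z - 1) * (K - f z))"
    proof -
      have "(1 - u) * (K * (extremal b z - 1) * (K - f z)) = K * ((extremal b z - 1) * (1 - u)) * (K - f z)"
        by (simp only: mult_ac)
      then show ?thesis by (simp only: v)
    qed
    finally show ?thesis using u1 by simp
  qed
  have f\<phi>: "\<phi> (f z) = extremal b z" if z: "norm z < 1" for z
  proof -
    have "K - f z \<noteq> 0"
    proof
      assume "K - f z = 0"
      then show False using root[OF z] K0 by (auto simp: algebra_simps)
    qed
    then show ?thesis using root[OF z] K0 by (simp add: \<phi>_def field_simps)
  qed
  have "best_bound \<phi> b"
  proof (rule best_boundI[OF b10])
    show "subordinate (extremal b) \<phi>"
    proof (rule extremal_subordinateI[OF hol\<phi> _ holf _ f\<phi>])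
      show "f 0 = 0" by (simp add: f_def)
      fix \<zeta> :: complex assume \<zeta>: "norm \<zeta> = 1"
      define c s where "c = Re \<zeta>" and "s = Im \<zeta>"
      have s2: "s\<^sup>2 = 1 - c\<^sup>2" and c1: "-1 \<le> c" "c \<le> 1"
        using unit_circle_Im[OF \<zeta>] unit_circle_Re[OF \<zeta>] by (auto simp: c_def s_def)
      have K\<zeta>: "K - \<zeta> \<noteq> 0" using K_ne[of \<zeta>] \<zeta> by simp
      define D where "D = K * K + \<zeta> * \<zeta>"
      have \<phi>D: "\<phi> \<zeta> = D / (K * (K - \<zeta>))"
        using K0 K\<zeta> by (simp add: \<phi>_def D_def field_simps)
      have ReD: "Re D = 2 * k + 2 * c\<^sup>2" and ImD: "Im D = 2 * c * s"
        using s2 kk by (simp_all add: D_def K_def c_def s_def power2_eq_square algebra_simps)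
      have nD: "(norm D)\<^sup>2 = 4 * (k * k) * (1 + c\<^sup>2)"
      proof -
        have "(norm D)\<^sup>2 = (2 * k + 2 * c\<^sup>2)\<^sup>2 + (2 * c)\<^sup>2 * (1 - c\<^sup>2)"
          unfolding cmod_power2 ReD ImD power_mult_distrib s2 by simp
        also have "\<dots> = 4 * (k * k) + 4 * c\<^sup>2 * (2 * k + 1)" by (simp add: power2_eq_square algebra_simps)
        finally show ?thesis unfolding kk[symmetric] by (simp add: algebra_simps)
      qed
      have D0: "D \<noteq> 0"
      proof -
        have "0 < (norm D)\<^sup>2" unfolding nD using k by (simp add: add_pos_nonneg)
        then show ?thesis by auto
      qed
      have N: "1 - 1 / \<phi> \<zeta> = \<zeta> * (\<zeta> + K) / D"
        unfolding \<phi>D using D0 K0 K\<zeta> by (simp add: D_def field_simps)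
      show "10 / 9 * norm (\<phi> \<zeta>) \<le> b * norm (\<phi> \<zeta> - 1) \<or> 8 / 9 \<le> \<bar>b * (1 - Re (1 / \<phi> \<zeta>))\<bar> \<or>
         (\<forall>z. norm z < 1 \<longrightarrow> nephroid_primitive z \<noteq> of_real b * (1 - 1 / \<phi> \<zeta>))"
      proof (cases "c \<le> 0")
        case True
        have "Re (\<zeta> * (\<zeta> + K)) = 2 * c\<^sup>2 - 1 + k * c" "Im (\<zeta> * (\<zeta> + K)) = s * (2 * c + k)"
          using s2 by (simp_all add: K_def c_def s_def power2_eq_square algebra_simps)
        then have "Re (1 - 1 / \<phi> \<zeta>) =
            ((2 * c\<^sup>2 - 1 + k * c) * (2 * k + 2 * c\<^sup>2) + s * (2 * c + k) * (2 * c * s)) / (norm D)\<^sup>2"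
          unfolding N cmod_power2 by (simp add: Re_divide ReD ImD add_divide_distrib)
        also have "(2 * c\<^sup>2 - 1 + k * c) * (2 * k + 2 * c\<^sup>2) + s * (2 * c + k) * (2 * c * s)
          = (2 * c\<^sup>2 - 1 + k * c) * (2 * k + 2 * c\<^sup>2) + (1 - c\<^sup>2) * (2 * c + k) * (2 * c)"
          unfolding s2[symmetric] by (simp add: power2_eq_square algebra_simps)
        also have "\<dots> = 2 * (c * c * (2 * k + 1) - k + c * (k * k + k))"
          by (simp add: power2_eq_square algebra_simps)
        also have "\<dots> = 2 * k * (k * (c * c) - 1 + c * (k + 1))"
          unfolding kk[symmetric] by (simp add: algebra_simps)
        finally have Re1: "Re (1 - 1 / \<phi> \<zeta>) = 2 * k * (k * (c * c) - 1 + c * (k + 1)) / (4 * (k * k) * (1 + c\<^sup>2))"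
          unfolding nD .
        \<comment> \<open>This product is the left-hand side of the next inequality minus its
          right-hand side; it vanishes at the contact point c = -1.\<close>
        have "c * (1 + c) * (k + 1) \<le> 0"
          using True c1 k by (intro mult_nonpos_nonneg) (auto intro: mult_nonpos_nonneg)
        then have "k * (c * c) - 1 + c * (k + 1) \<le> - (1 + c\<^sup>2)"
          by (simp add: power2_eq_square algebra_simps)
        then have "2 * k * (k * (c * c) - 1 + c * (k + 1)) \<le> 2 * k * (- (1 + c\<^sup>2))"
          using k by (intro mult_left_mono) auto
        then have "Re (1 - 1 / \<phi> \<zeta>) \<le> 2 * k * (- (1 + c\<^sup>2)) / (4 * (k * k) * (1 + c\<^sup>2))"
          unfolding Re1 by (intro divide_right_mono) (auto intro: add_nonneg_nonneg)
        also have "\<dots> = - (1 / (2 * k))"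
        proof -
          have "2 * k * (- X) / (4 * (k * k) * X) = - (1 / (2 * k))" if "X \<noteq> 0" for X
            using k that by (simp add: field_simps)
          moreover have "1 + c\<^sup>2 \<noteq> 0" using zero_le_power2[of c] by linarith
          ultimately show ?thesis by blast
        qed
        finally have "b * (1 - Re (1 / \<phi> \<zeta>)) \<le> b * (- (1 / (2 * k)))"
          using b10 by (intro mult_left_mono) auto
        also have "\<dots> = - (8 / 9)" using k by (simp add: b_def)
        finally show ?thesis by linarith
      next
        case False
        have "(norm (\<zeta> + K))\<^sup>2 = k * k + 2 * k * c + 1"
          using s2 unfolding cmod_power2 by (simp add: K_def c_def s_def power2_eq_square algebra_simps)
        moreover have "0 \<le> 2 * k * c" using False k by simp
        moreover have "c\<^sup>2 \<le> 1" using c1 by (simp add: abs_square_le_1)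
        ultimately have "25 / 64 * (4 * (1 + c\<^sup>2)) \<le> (norm (\<zeta> + K))\<^sup>2"
          unfolding kk using k by (simp add: field_simps)
        then have "(k * k) * (25 / 64 * (4 * (1 + c\<^sup>2))) \<le> (k * k) * (norm (\<zeta> + K))\<^sup>2"
          by (intro mult_left_mono) auto
        then have "(5 / 8 * norm D)\<^sup>2 \<le> (k * norm (\<zeta> + K))\<^sup>2"
          unfolding power_mult_distrib nD by (simp add: power2_eq_square mult_ac)
        then have D_le: "5 / 8 * norm D \<le> k * norm (\<zeta> + K)"
          by (rule power2_le_imp_le) (use k in simp)
        have "\<phi> \<zeta> - 1 = \<zeta> * (\<zeta> + K) / (K * (K - \<zeta>))"
          using K0 K\<zeta> by (simp add: \<phi>_def field_simps)
        then have \<phi>1: "norm (\<phi> \<zeta> - 1) = norm (\<zeta> + K) / norm (K * (K - \<zeta>))"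
          using \<zeta> by (simp add: norm_divide norm_mult)
        have "5 / 8 * norm (\<phi> \<zeta>) = 5 / 8 * norm D / norm (K * (K - \<zeta>))"
          unfolding \<phi>D by (simp add: norm_divide)
        also have "\<dots> \<le> k * norm (\<zeta> + K) / norm (K * (K - \<zeta>))"
          by (rule divide_right_mono[OF D_le norm_ge_zero])
        finally have "5 / 8 * norm (\<phi> \<zeta>) \<le> k * norm (\<phi> \<zeta> - 1)"
          by (simp add: \<phi>1)
        then show ?thesis by (simp add: b_def)
      qed
    qed (use b10 in simp_all)
    fix \<beta> assume \<beta>: "10 / 9 < \<beta>" "\<beta> < b"
    have "((\<lambda>r::real. 1 / (1 - (r - r ^ 3 / 9) / \<beta>)) \<longlongrightarrow> 1 / (1 - (- 1 - (- 1) ^ 3 / 9) / \<beta>)) (at_right (- 1))"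
      using \<beta> by (intro tendsto_intros) (auto simp: field_simps)
    moreover have "1 / (1 - (- 1 - (- 1) ^ 3 / 9) / \<beta>) < m"
    proof -
      \<comment> \<open>Since m = 2 k - 4, the factor 5 - 2 k is 1 - m and 16 (k - 2) is 8 m; the
        goal is 9 \<beta> (1 - m) < 8 m.\<close>
      have "9 * \<beta> < 16 * k" using \<beta> by (simp add: b_def)
      then have "9 * \<beta> * (5 - 2 * k) < 16 * k * (5 - 2 * k)"
        using k by (intro mult_strict_right_mono) auto
      also have "\<dots> = 16 * (k - 2)" using kk by (simp add: algebra_simps)
      finally have "9 * \<beta> < m * (9 * \<beta> + 8)" by (simp add: m_def k_def algebra_simps)
      then show ?thesis using \<beta> by (simp add: field_simps)
    qed
    ultimately have "\<forall>\<^sub>F r::real in at_right (- 1). 1 / (1 - (r - r ^ 3 / 9) / \<beta>) < m"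
      by (rule order_tendstoD)
    moreover have "\<forall>\<^sub>F r::real in at_right (- 1). r \<in> {- 1<..<0}"
      by (rule eventually_at_right_real) simp
    ultimately have "\<forall>\<^sub>F r::real in at_right (- 1). \<bar>r\<bar> < 1 \<and> 1 / (1 - (r - r ^ 3 / 9) / \<beta>) < m"
      by eventually_elim auto
    then obtain r where r: "\<bar>r\<bar> < 1" "1 / (1 - (r - r ^ 3 / 9) / \<beta>) < m"
      using eventually_happens'[OF trivial_limit_at_right_real] by blast
    define v where "v = 1 / (1 - (r - r ^ 3 / 9) / \<beta>)"
    have v0: "0 < v"
      using Re_extremal_gt_half[of \<beta> "of_real r"] \<beta> r(1) unfolding extremal_of_real v_def[symmetric] by simp
    have vm: "v < m" using r by (simp add: v_def)
    have "\<phi> w \<noteq> of_real v" if w: "norm w < 1" for w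
    proof
      assume eq: "\<phi> w = of_real v"
      define x y where "x = Re w" and "y = Im w"
      have "w * (K + w) / (K * (K - w)) = of_real v - 1" using eq by (simp add: \<phi>_def algebra_simps)
      moreover have "K * (K - w) \<noteq> 0" using K0 K_ne[of w] w by simp
      ultimately have "w * (K + w) = (of_real v - 1) * (K * (K - w))" by (simp add: divide_eq_eq)
      then have quad: "w * w + K * of_real v * w + K * K * (1 - of_real v) = 0"
        by (simp add: algebra_simps)
      have re: "x * x - y * y + k * v * x + k * k * (1 - v) = 0"
        using arg_cong[OF quad, of Re] by (simp add: K_def x_def y_def)
      have im: "y * (2 * x + k * v) = 0"
        using arg_cong[OF quad, of Im] by (simp add: K_def x_def y_def algebra_simps)
      have xy: "x * x + y * y < 1"
        using w cmod_power2[of w] abs_square_less_1[of "norm w"] by (simp add: x_def y_def power2_eq_square)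
      have m: "0 < m" "(m + 2) * (m + 2) = 8" using sqrt2_bounds by (simp_all add: m_def)
      have kv: "1 < k * k * (1 - v)"
      proof -
        have "k * k * (1 - m) = 1" unfolding kk by (simp add: m_def k_def algebra_simps)
        moreover have "k * k * (1 - m) < k * k * (1 - v)" using k vm by (intro mult_strict_left_mono) auto
        ultimately show ?thesis by simp
      qed
      \<comment> \<open>For v = m the quadratic is (w + 1)^2. For 0 < v < m its discriminant k^2
        (v^2 + 4 v - 4) is negative, since m is the positive root of v^2 + 4 v - 4. So the roots are
        conjugate, and their product k^2 (1 - v) > k^2 (1 - m) = 1 puts them outside the
        disk.\<close>
      show False
      proof (cases "y = 0")
        case True
        have "(v + 2) * (v + 2) < (m + 2) * (m + 2)"
          using v0 vm by (intro mult_strict_mono) auto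
        then have neg: "v * v + 4 * v - 4 < 0" unfolding m(2) by (simp add: algebra_simps)
        have "(2 * x + k * v)\<^sup>2 = k * k * (v * v + 4 * v - 4) + 4 * (x * x + k * v * x + k * k * (1 - v))"
          by (simp add: power2_eq_square algebra_simps)
        also have "\<dots> = k * k * (v * v + 4 * v - 4)" using re True by simp
        also have "\<dots> < 0" using neg k by (simp add: mult_pos_neg)
        finally show False by (simp add: power2_less_0)
      next
        case False
        then have "k * v = - 2 * x" using im by simp
        then have "x * x + y * y = k * k * (1 - v)" using re by simp
        then show False using xy kv by simp
      qed
    qed
    then show "\<exists>r. \<bar>r\<bar> < 1 \<and> (\<forall>w. norm w < 1 \<longrightarrow> \<phi> w \<noteq> of_real (1 / (1 - (r - r ^ 3 / 9) / \<beta>)))"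
      using r(1) unfolding v_def by blast
  qed
  then show ?thesis
    by (simp add: \<phi>_def [abs_def] b_def K_def k_def Let_def)
qed

theorem theorem5p3:
  "best_bound (\<lambda>z. csqrt (1 + z\<^sup>2) + z) (4 / 9 * (2 + sqrt 2)) \<and>
   best_bound (\<lambda>z. 1 + 4 / 3 * z + 2 / 3 * z\<^sup>2) (4 / 3) \<and>
   best_bound (\<lambda>z. 1 + of_real (sqrt 2) * z + 1 / 2 * z\<^sup>2) (8 / 63 * (5 + 4 * sqrt 2)) \<and>
   best_bound (\<lambda>z. exp z) (8 * exp 1 / (9 * (exp 1 - 1))) \<and>
   best_bound (\<lambda>z. 1 + sin z) (8 * (1 + sin 1) / (9 * sin 1)) \<and>
   best_bound (\<lambda>z. let k = of_real (1 + sqrt 2) in 1 + z / k * ((k + z) / (k - z)))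
     (16 / 9 * (1 + sqrt 2)) \<and>
   best_bound phi_Ne (20 / 9)"
  using best_bound_crescent best_bound_cardioid best_bound_limacon best_bound_exp best_bound_sine
    best_bound_rational best_bound_nephroid by blast

end
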